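(* Fix $p\in(0,1]$ and let $H_{n,p}$ denote the height of the $p$-percolated uniform temporal tree $\mathcal{T}_{n,p}$. Then $$\frac{H_{n,p}}{np}\to e \quad\text{and}\quad \frac{H_{n,p}}{\log|\mathcal{T}_{n,p}|}\to e$$ in probability as $n\to\infty$.
   Context: For a positive integer $n$, let $T_n$ be the rooted infinite complete $n$-ary tree (every vertex has exactly $n$ children). To each edge $e$ of $T_n$ assign an independent random variable $U_e$ uniformly distributed on $[0,1]$. The label $\ell_v$ of a non-root vertex $v$ is $U_e$, where $e$ is the edge joining $v$ to its parent. For $p\in(0,1]$, assign the root the label $p$. The $p$-percolated uniform temporal tree $\mathcal{T}_{n,p}$ is the random rooted tree obtained from $T_n$ by deleting all vertices $v$ for which the vertex labels along the path from the root to $v$ are not decreasing. (Thus a vertex $v$ of $T_n$ is kept exactly when the labels read along the path from the root to $v$, starting with the label $p$ of the root, are decreasing.) The tree is almost surely finite. $|\mathcal{T}_{n,p}|$ denotes its number of vertices. The depth of a vertex is the number of edges on the path from the root to it, and the height is the maximum depth of a vertex of the tree. Here $e=\exp(1)$ and $\log$ is the natural logarithm. On the event $|\mathcal{T}_{n,p}|=1$ the ratio $H_{n,p}/\log|\mathcal{T}_{n,p}|$ is given an arbitrary fixed value, e.g. $0$. *)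

theory Defs
  imports "HOL-Probability.Probability"
begin

text \<open>
  Vertices of the complete $n$-ary tree are words over the alphabet of size $n$: the root is the
  empty word, the children of a vertex \<open>v\<close> are the words \<open>v @ [i]\<close> with \<open>i < n\<close>, the depth
  of \<open>v\<close> is its length, and the path from the root to \<open>v\<close> visits
  \<open>take 0 v, take 1 v, \<dots>, take (length v) v = v\<close>.
  The edge joining a non-root vertex \<open>v\<close> to its parent \<open>butlast v\<close> is represented by its lower
  endpoint \<open>v\<close>.
\<close>

definition tree_vertices :: "nat \<Rightarrow> nat list set" where
  "tree_vertices n = lists {..<n}"

definition tree_edges :: "nat \<Rightarrow> nat list set" where
  "tree_edges n = tree_vertices n - {[]}"

definition iid_uniform_edges :: "nat \<Rightarrow> 'a measure \<Rightarrow> (nat list \<Rightarrow> 'a \<Rightarrow> real) \<Rightarrow> bool" where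
  "iid_uniform_edges n M U \<longleftrightarrow>
     prob_space M \<and>
     prob_space.indep_vars M (\<lambda>_. borel) U (tree_edges n) \<and>
     (\<forall>e\<in>tree_edges n. distr M borel (U e) = uniform_measure lborel {0..1})"

definition vertex_label :: "real \<Rightarrow> (nat list \<Rightarrow> real) \<Rightarrow> nat list \<Rightarrow> real" where
  "vertex_label p u v = (if v = [] then p else u v)"

text \<open>
  The vertex set determines the tree, because it is closed under taking prefixes. Labels are
  required to decrease strictly; ties between labels have probability zero.
\<close>

definition temporal_tree :: "nat \<Rightarrow> real \<Rightarrow> (nat list \<Rightarrow> real) \<Rightarrow> nat list set" where
  "temporal_tree n p u =
     {v \<in> tree_vertices n.
        strict_antimono_on {0..length v} (\<lambda>k. vertex_label p u (take k v))}"

text \<open>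
  Meaningful for finite trees. On the null event of an infinite temporal tree, \<open>Max\<close> and \<open>card\<close>
  take fixed default values.
\<close>

definition tree_height :: "nat list set \<Rightarrow> nat" where
  "tree_height T = Max (length ` T)"

text \<open>
  Convergence in probability to a constant. Each variable may live on its own probability
  space, and only the tail of the sequence matters. Measurability is demanded explicitly, because
  \<open>measure\<close> is \<open>0\<close> on non-measurable sets.
\<close>

definition tends_in_prob :: "(nat \<Rightarrow> 'a measure) \<Rightarrow> (nat \<Rightarrow> 'a \<Rightarrow> real) \<Rightarrow> real \<Rightarrow> bool" where
  "tends_in_prob M X c \<longleftrightarrow>
     (\<forall>\<^sub>F n in sequentially. X n \<in> borel_measurable (M n)) \<and>
     (\<forall>\<epsilon>>0. (\<lambda>n. measure (M n) {\<omega> \<in> space (M n). \<bar>X n \<omega> - c\<bar> > \<epsilon>}) \<longlonglongrightarrow> 0)"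

end

theory Submission
  imports Defs "HOL-Real_Asymp.Real_Asymp"
begin

text \<open>
  The subtree hanging below a child of the root with label \<open>y\<close> is again a temporal tree, with root
  label \<open>y\<close>, and the subtrees of distinct children are independent. Hence every expectation of the
  form \<open>c ^ (number of vertices of depth below k) * z ^ (number of vertices of depth k)\<close> obeys a
  recursion in \<open>k\<close>: its complement to \<open>1\<close>, the deficit, turns from \<open>g\<close> into
  \<open>1 - c * (1 - integral {0..x} g) ^ n\<close> (lemma \<open>expectation_gen_weight\<close>). All
  asymptotics are then read off from this deterministic recursion.

  For \<open>c = 1\<close> and \<open>z = 0\<close> the deficit is the probability that level \<open>k\<close> is inhabited, that is, that
  the height is at least \<open>k\<close>. Bernoulli's inequality bounds it by the expected level size
  \<open>(n * x) ^ k / fact k\<close>, which vanishes once \<open>k\<close> exceeds \<open>\<kappa> * n * p\<close> with \<open>\<kappa> > exp 1\<close>. For the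
  opposite bound, \<open>1 - (1 - I) ^ n \<ge> 1 - exp (- n * I)\<close> makes the recursion nearly linear as long as
  the deficit is small. So a bound \<open>q\<close> valid for \<open>n * x \<ge> \<tau>\<close> becomes, after \<open>m\<close>
  generations, at least \<open>(1 - \<eta>) ^ m * q * L ^ m / fact m\<close> at \<open>n * x = \<tau> + L\<close>. For \<open>L = m / \<kappa>\<close> with
  \<open>\<kappa> < exp 1\<close>, \<open>\<eta>\<close> small and \<open>m\<close> large the factor multiplying \<open>q\<close> is at least \<open>1\<close>, so the bound travels at
  \<open>\<kappa>\<close> generations per unit of \<open>n * x\<close>
  (lemma \<open>nonempty_level_travels\<close>). This is the supercritical regime of a branching random walk.
  The many children of the root with label close to \<open>p\<close> finally turn the positive constant \<open>q\<close> into
  a probability tending to \<open>1\<close> (lemma \<open>nonempty_level_boost\<close>).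

  For \<open>c = z = s\<close> the expectation is the generating function of the truncated size. As the depth of
  truncation and then \<open>n\<close> grow (with \<open>n * x\<close> fixed) it approaches
  \<open>s / (s + (1 - s) * exp (n * x))\<close>, the generating function of a Yule process: the size behaves like a geometric
  variable with mean \<open>exp (n * x)\<close>. Taking \<open>s = exp (- 1 / A)\<close> with \<open>A = exp ((1 \<plusminus> \<epsilon>) * n * p)\<close> and
  Markov's inequality give \<open>ln (size) / (n * p) \<longrightarrow> 1\<close> in probability, and the second claim is the
  quotient of the two limits.
\<close>

section \<open>Self-similarity of the temporal tree\<close>

lemma Nil_in_temporal_tree: "[] \<in> temporal_tree n x u"
  by (simp add: temporal_tree_def tree_vertices_def monotone_on_def)

lemma strict_antimono_on_0_Suc:
  fixes f :: "nat \<Rightarrow> real"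
  shows "strict_antimono_on {0..Suc l} f \<longleftrightarrow> f 1 < f 0 \<and> strict_antimono_on {0..l} (\<lambda>j. f (Suc j))"
proof
  assume "strict_antimono_on {0..Suc l} f"
  then show "f 1 < f 0 \<and> strict_antimono_on {0..l} (\<lambda>j. f (Suc j))"
    by (auto simp: monotone_on_def)
next
  assume *: "f 1 < f 0 \<and> strict_antimono_on {0..l} (\<lambda>j. f (Suc j))"
  show "strict_antimono_on {0..Suc l} f"
  proof (rule monotone_onI)
    fix a b assume ab: "a \<in> {0..Suc l}" "b \<in> {0..Suc l}" "a < b"
    then obtain b' where b: "b = Suc b'" "b' \<le> l" by (cases b) auto
    have below_1: "f (Suc b') \<le> f 1"
      using * b by (cases b') (auto simp: monotone_on_def intro!: less_imp_le)
    show "f a > f b"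
    proof (cases a)
      case 0
      then show ?thesis using * below_1 b by auto
    next
      case (Suc a')
      then show ?thesis using * ab b by (auto simp: monotone_on_def)
    qed
  qed
qed

text \<open>
  The path to \<open>i # w\<close> is the edge to the child \<open>[i]\<close> followed by the path \<open>w\<close> inside its subtree,
  where the label of \<open>[i]\<close> takes over the role of the root label.
\<close>

lemma Cons_in_temporal_tree:
  "i # w \<in> temporal_tree n x u \<longleftrightarrow>
     i < n \<and> u [i] < x \<and> w \<in> temporal_tree n (u [i]) (\<lambda>w. u (i # w))"
proof -
  have "vertex_label (u [i]) (\<lambda>w. u (i # w)) v = vertex_label x u (i # v)" for v
    by (simp add: vertex_label_def)
  then show ?thesis
    unfolding temporal_tree_def tree_vertices_def
    by (simp add: strict_antimono_on_0_Suc) (auto simp: vertex_label_def)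
qed

lemma temporal_tree_subset: "temporal_tree n x u \<subseteq> lists {..<n}"
  by (auto simp: temporal_tree_def tree_vertices_def)

lemma finite_words: "finite {v \<in> lists {..<n::nat}. length v < k}"
proof -
  have "{v \<in> lists {..<n}. length v < k} = (\<Union>l<k. {v. set v \<subseteq> {..<n} \<and> length v = l})"
    by auto
  then show ?thesis by (auto intro: finite_lists_length_eq)
qed

definition tree_level :: "nat \<Rightarrow> nat list set \<Rightarrow> nat list set" where
  "tree_level k T = {v \<in> T. length v = k}"

definition tree_below :: "nat \<Rightarrow> nat list set \<Rightarrow> nat list set" where
  "tree_below k T = {v \<in> T. length v < k}"

lemma finite_tree_below: "finite (tree_below k (temporal_tree n x u))"
  by (rule finite_subset[OF _ finite_words[of n k]]) (use temporal_tree_subset[of n x u] in \<open>auto simp: tree_below_def\<close>)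

lemma finite_tree_level: "finite (tree_level k (temporal_tree n x u))"
  by (rule finite_subset[OF _ finite_tree_below[of "Suc k" n x u]]) (auto simp: tree_below_def tree_level_def)

lemma card_Cons_image_Union:
  assumes "finite I" "\<And>i. i \<in> I \<Longrightarrow> finite (A i)"
  shows "card (\<Union>i\<in>I. (#) i ` A i) = (\<Sum>i\<in>I. card (A i))"
proof -
  have "card (\<Union>i\<in>I. (#) i ` A i) = (\<Sum>i\<in>I. card ((#) i ` A i))"
    using assms by (intro card_UN_disjoint) auto
  then show ?thesis by (simp add: card_image)
qed

text \<open>
  The weight is kept closed under the recursion below by treating the last level separately from
  the levels above it. With \<open>c = 1\<close> and \<open>z = 0\<close> it is the indicator of an empty level \<open>k\<close>, because
  \<open>0 ^ 0 = 1\<close>; with \<open>c = z\<close> it is the generating function of the size.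
\<close>

definition gen_weight :: "nat \<Rightarrow> real \<Rightarrow> real \<Rightarrow> nat \<Rightarrow> real \<Rightarrow> (nat list \<Rightarrow> real) \<Rightarrow> real" where
  "gen_weight n c z k x u =
     c ^ card (tree_below k (temporal_tree n x u)) * z ^ card (tree_level k (temporal_tree n x u))"

lemma gen_weight_0: "gen_weight n c z 0 x u = z"
proof -
  have "tree_level 0 (temporal_tree n x u) = {[]}"
    using Nil_in_temporal_tree by (auto simp: tree_level_def)
  moreover have "tree_below 0 (temporal_tree n x u) = {}"
    by (auto simp: tree_below_def)
  ultimately show ?thesis by (simp add: gen_weight_def)
qed

text \<open>
  Cardinalities add up over the subtrees of the children, so the weight factorises. A child whose
  label is not below \<open>x\<close> is deleted together with its subtree and contributes the factor \<open>1\<close>.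
\<close>

lemma gen_weight_Suc:
  "gen_weight n c z (Suc k) x u =
     c * (\<Prod>i<n. if u [i] < x then gen_weight n c z k (u [i]) (\<lambda>w. u (i # w)) else 1)"
proof -
  define I where "I = {i. i < n \<and> u [i] < x}"
  define T where "T = (\<lambda>i. temporal_tree n (u [i]) (\<lambda>w. u (i # w)))"
  have I: "finite I" by (auto simp: I_def)
  have below: "tree_below (Suc k) (temporal_tree n x u) = insert [] (\<Union>i\<in>I. (#) i ` tree_below k (T i))"
  proof (rule set_eqI)
    fix v show "v \<in> tree_below (Suc k) (temporal_tree n x u) \<longleftrightarrow>
        v \<in> insert [] (\<Union>i\<in>I. (#) i ` tree_below k (T i))"
      by (cases v) (auto simp: tree_below_def I_def T_def Cons_in_temporal_tree Nil_in_temporal_tree)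
  qed
  have level: "tree_level (Suc k) (temporal_tree n x u) = (\<Union>i\<in>I. (#) i ` tree_level k (T i))"
  proof (rule set_eqI)
    fix v show "v \<in> tree_level (Suc k) (temporal_tree n x u) \<longleftrightarrow> v \<in> (\<Union>i\<in>I. (#) i ` tree_level k (T i))"
      by (cases v) (auto simp: tree_level_def I_def T_def Cons_in_temporal_tree)
  qed
  have "card (tree_below (Suc k) (temporal_tree n x u)) = Suc (\<Sum>i\<in>I. card (tree_below k (T i)))"
    unfolding below using I finite_tree_below
    by (subst card_insert_disjoint) (auto simp: card_Cons_image_Union T_def)
  moreover have "card (tree_level (Suc k) (temporal_tree n x u)) = (\<Sum>i\<in>I. card (tree_level k (T i)))"
    unfolding level using I finite_tree_level by (subst card_Cons_image_Union) (auto simp: T_def)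
  ultimately have "gen_weight n c z (Suc k) x u =
      c * (\<Prod>i\<in>I. gen_weight n c z k (u [i]) (\<lambda>w. u (i # w)))"
    by (simp add: gen_weight_def power_sum prod.distrib T_def)
  also have "(\<Prod>i\<in>I. gen_weight n c z k (u [i]) (\<lambda>w. u (i # w))) =
      (\<Prod>i<n. if u [i] < x then gen_weight n c z k (u [i]) (\<lambda>w. u (i # w)) else 1)"
    by (subst prod.inter_filter[symmetric]) (auto simp: I_def)
  finally show ?thesis .
qed

lemma gen_weight_bounds:
  assumes "0 \<le> c" "c \<le> 1" "0 \<le> z" "z \<le> 1"
  shows "0 \<le> gen_weight n c z k x u" "gen_weight n c z k x u \<le> 1"
  using assms by (auto simp: gen_weight_def intro!: mult_le_one power_le_one)

lemma tree_edges_Cons: "i < n \<Longrightarrow> w \<in> tree_edges n \<Longrightarrow> i # w \<in> tree_edges n"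
  and tree_edges_single: "i < n \<Longrightarrow> [i] \<in> tree_edges n"
  by (auto simp: tree_edges_def tree_vertices_def)

text \<open>
  The weight of a subtree depends on the labels of that subtree alone; this is what makes distinct
  subtrees independent, and it allows the labels outside the edge set to be replaced by \<open>undefined\<close>.
\<close>

lemma gen_weight_cong:
  "(\<And>e. e \<in> tree_edges n \<Longrightarrow> u e = u' e) \<Longrightarrow> gen_weight n c z k x u = gen_weight n c z k x u'"
proof (induction k arbitrary: x u u')
  case 0
  show ?case by (simp add: gen_weight_0)
next
  case (Suc k)
  have "gen_weight n c z k y (\<lambda>w. u (i # w)) = gen_weight n c z k y (\<lambda>w. u' (i # w))" if "i < n" for y i
    using that by (intro Suc.IH Suc.prems) (auto intro: tree_edges_Cons)
  then show ?case
    unfolding gen_weight_Suc using Suc.prems[OF tree_edges_single]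
    by (intro arg_cong2[where f = "(*)"] prod.cong) auto
qed

abbreviation edge_labels :: "nat \<Rightarrow> (nat list \<Rightarrow> real) measure" where
  "edge_labels n \<equiv> PiM (tree_edges n) (\<lambda>_. borel)"

lemma measurable_subtree_labels:
  assumes "\<And>w. w \<in> tree_edges n \<Longrightarrow> i # w \<in> B"
  shows "(\<lambda>u. \<lambda>w\<in>tree_edges n. u (i # w)) \<in> PiM B (\<lambda>_. borel) \<rightarrow>\<^sub>M edge_labels n"
  using assms by (intro measurable_restrict measurable_component_singleton) auto

text \<open>
  Joint measurability in the root label and the edge labels is needed since in the recursion the
  root label of a subtree is itself random.
\<close>

lemma measurable_gen_weight:
  "(\<lambda>(x, u). gen_weight n c z k x u) \<in> borel_measurable (borel \<Otimes>\<^sub>M edge_labels n)"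
proof (induction k)
  case 0
  show ?case by (simp add: gen_weight_0)
next
  case (Suc k)
  have [measurable]: "(\<lambda>p. gen_weight n c z k (snd p [i]) (\<lambda>w. snd p (i # w)))
      \<in> borel_measurable (borel \<Otimes>\<^sub>M edge_labels n)" if i: "i < n" for i
  proof -
    have "(\<lambda>u. (u [i], \<lambda>w\<in>tree_edges n. u (i # w))) \<in> edge_labels n \<rightarrow>\<^sub>M borel \<Otimes>\<^sub>M edge_labels n"
      using i by (intro measurable_Pair measurable_subtree_labels measurable_component_singleton
          tree_edges_single tree_edges_Cons)
    then have "(\<lambda>p. (snd p [i], \<lambda>w\<in>tree_edges n. snd p (i # w)))
        \<in> borel \<Otimes>\<^sub>M edge_labels n \<rightarrow>\<^sub>M borel \<Otimes>\<^sub>M edge_labels n"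
      by (rule measurable_compose[OF measurable_snd])
    from measurable_compose[OF this Suc]
    show ?thesis
      by (auto cong: gen_weight_cong)
  qed
  have [measurable]: "(\<lambda>p. snd p [i]) \<in> borel_measurable (borel \<Otimes>\<^sub>M edge_labels n)" if "i < n" for i
    using that by (auto intro!: measurable_compose[OF measurable_snd]
          measurable_component_singleton tree_edges_single)
  show ?case
    unfolding gen_weight_Suc case_prod_beta by measurable
qed

section \<open>The deficit recursion\<close>

text \<open>
  One minus the expected weight of a tree with root label \<open>x\<close>, see \<open>expectation_gen_weight\<close>. In the
  recursion, \<open>integral {0..x} (deficit n c z k)\<close> is the expected loss caused by one child, averaged
  over its uniform label.
\<close>

primrec deficit :: "nat \<Rightarrow> real \<Rightarrow> real \<Rightarrow> nat \<Rightarrow> real \<Rightarrow> real" where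
  "deficit n c z 0 = (\<lambda>x. 1 - z)"
| "deficit n c z (Suc k) = (\<lambda>x. 1 - c * (1 - integral {0..x} (deficit n c z k)) ^ n)"

lemma deficit_bounds_continuous:
  assumes "0 \<le> c" "c \<le> 1" "0 \<le> z" "z \<le> 1"
  shows "continuous_on {0..1} (deficit n c z k) \<and>
         (\<forall>x\<in>{0..1}. 0 \<le> deficit n c z k x \<and> deficit n c z k x \<le> 1)"
proof (induction k)
  case 0
  then show ?case using assms by auto
next
  case (Suc k)
  let ?g = "deficit n c z k"
  have int: "?g integrable_on {0..1}"
    using Suc by (intro integrable_continuous_real) auto
  have "continuous_on {0..1} (deficit n c z (Suc k))"
    by (auto intro!: continuous_intros indefinite_integral_continuous_1[OF int])
  moreover have "0 \<le> deficit n c z (Suc k) x \<and> deficit n c z (Suc k) x \<le> 1" if x: "x \<in> {0..1}" for x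
  proof -
    have "?g integrable_on {0..x}"
      by (rule integrable_subinterval_real[OF int]) (use x in auto)
    then have "0 \<le> integral {0..x} ?g" "integral {0..x} ?g \<le> integral {0..x} (\<lambda>_. 1)"
      using Suc x by (auto intro!: integral_nonneg integral_le simp del: integral_const_real)
    then have "0 \<le> (1 - integral {0..x} ?g) ^ n" "(1 - integral {0..x} ?g) ^ n \<le> 1"
      using x by (auto intro!: power_le_one)
    then show ?thesis
      using assms by (auto intro: mult_le_one)
  qed
  ultimately show ?case by blast
qed

context
  fixes n :: nat and c z :: real
  assumes c: "0 \<le> c" "c \<le> 1" and z: "0 \<le> z" "z \<le> 1"
begin

lemma deficit_nonneg: "0 \<le> x \<Longrightarrow> x \<le> 1 \<Longrightarrow> 0 \<le> deficit n c z k x"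
  and deficit_le_1: "0 \<le> x \<Longrightarrow> x \<le> 1 \<Longrightarrow> deficit n c z k x \<le> 1"
  and deficit_continuous: "continuous_on {0..1} (deficit n c z k)"
  using deficit_bounds_continuous[OF c z] by auto

lemma deficit_integrable: "0 \<le> a \<Longrightarrow> x \<le> 1 \<Longrightarrow> deficit n c z k integrable_on {a..x}"
  by (intro integrable_continuous_real continuous_on_subset[OF deficit_continuous]) auto

lemma deficit_integral_bounds:
  assumes "0 \<le> x" "x \<le> 1"
  shows "0 \<le> integral {0..x} (deficit n c z k)" "integral {0..x} (deficit n c z k) \<le> x"
proof -
  have "integral {0..x} (deficit n c z k) \<le> integral {0..x} (\<lambda>_. 1)"
    using assms by (intro integral_le deficit_integrable) (auto intro: deficit_le_1)
  then show "integral {0..x} (deficit n c z k) \<le> x"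
    using assms by simp
  show "0 \<le> integral {0..x} (deficit n c z k)"
    using assms by (intro integral_nonneg deficit_integrable) (auto intro: deficit_nonneg)
qed

lemma deficit_mono:
  assumes "0 \<le> x" "x \<le> y" "y \<le> 1"
  shows "deficit n c z k x \<le> deficit n c z k y"
proof (cases k)
  case (Suc j)
  have "integral {0..x} (deficit n c z j) \<le> integral {0..y} (deficit n c z j)"
    using assms by (intro integral_subset_le deficit_integrable) (auto intro: deficit_nonneg)
  moreover have "integral {0..y} (deficit n c z j) \<le> 1"
    using deficit_integral_bounds(2)[of y j] assms by auto
  ultimately show ?thesis
    using c by (auto simp: Suc intro!: mult_left_mono power_mono)
qed simp

text \<open>
  A union bound over the \<open>n\<close> children, in the form of Bernoulli's inequality.
\<close>

lemma deficit_Suc_le: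
  assumes "0 \<le> x" "x \<le> 1"
  shows "deficit n c z (Suc k) x \<le> (1 - c) + n * integral {0..x} (deficit n c z k)"
proof -
  define I where "I = integral {0..x} (deficit n c z k)"
  have I: "0 \<le> I" "I \<le> 1"
    using deficit_integral_bounds[OF assms, of k] assms by (auto simp: I_def)
  have "1 - n * I \<le> (1 - I) ^ n"
    using Bernoulli_inequality[of "- I" n] I by simp
  then have "1 - (1 - I) ^ n \<le> n * I" by simp
  moreover have "c * (1 - (1 - I) ^ n) \<le> 1 * (1 - (1 - I) ^ n)"
    using c I by (intro mult_right_mono) (auto simp: power_le_one)
  ultimately show ?thesis
    by (simp add: I_def algebra_simps)
qed

text \<open>
  The Poisson approximation \<open>(1 - I) ^ n \<le> exp (- n * I)\<close> of the number of children errs in the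
  useful direction.
\<close>

lemma deficit_Suc_ge:
  assumes "0 \<le> x" "x \<le> 1"
  shows "deficit n c z (Suc k) x \<ge> 1 - c * exp (- (n * integral {0..x} (deficit n c z k)))"
proof -
  define I where "I = integral {0..x} (deficit n c z k)"
  have I: "0 \<le> I" "I \<le> 1"
    using deficit_integral_bounds[OF assms, of k] assms by (auto simp: I_def)
  have "(1 - I) ^ n \<le> exp (- I) ^ n"
    using I exp_ge_add_one_self[of "- I"] by (intro power_mono) auto
  also have "\<dots> = exp (- (n * I))"
    by (simp add: exp_of_nat_mult[symmetric])
  finally show ?thesis
    using c by (auto simp: I_def[symmetric] intro!: mult_left_mono)
qed

end

section \<open>Expected generating weights\<close>

text \<open>
  Relabelling \<open>w\<close> as \<open>i # w\<close> is injective, and so preserves independence: restrict the family to the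
  singletons \<open>{i # w}\<close>.
\<close>

lemma iid_uniform_edges_subtree:
  assumes iid: "iid_uniform_edges n M U" and i: "i < n"
  shows "iid_uniform_edges n M (\<lambda>w. U (i # w))"
proof -
  interpret prob_space M using iid by (simp add: iid_uniform_edges_def)
  have "indep_vars (\<lambda>w. PiM {i # w} (\<lambda>_. borel)) (\<lambda>w \<omega>. \<lambda>e\<in>{i # w}. U e \<omega>) (tree_edges n)"
    using iid i
    by (intro indep_vars_restrict[where I = "tree_edges n"])
       (auto simp: iid_uniform_edges_def disjoint_family_on_def tree_edges_Cons)
  then have "indep_vars (\<lambda>_. borel) (\<lambda>w \<omega>. (\<lambda>u. u (i # w)) (\<lambda>e\<in>{i # w}. U e \<omega>)) (tree_edges n)"
    by (rule indep_vars_compose2) (auto intro: measurable_component_singleton)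
  then have "indep_vars (\<lambda>_. borel) (\<lambda>w. U (i # w)) (tree_edges n)"
    by simp
  then show ?thesis
    using iid i tree_edges_Cons by (auto simp: iid_uniform_edges_def)
qed

lemma integral_uniform_01:
  fixes f :: "real \<Rightarrow> real"
  assumes "f \<in> borel_measurable borel"
  shows "(\<integral>y. f y \<partial>uniform_measure lborel {0..1}) = (\<integral>y. indicator {0..1} y * f y \<partial>lborel)"
proof -
  have "uniform_measure lborel {0..1::real} = density lborel (\<lambda>y. ennreal (indicator {0..1} y))"
    by (auto simp: uniform_measure_def divide_ennreal_def ennreal_indicator intro!: density_cong)
  then show ?thesis
    using assms by (simp add: integral_real_density)
qed

text \<open>
  The factor of one child, integrated over its uniform label \<open>y\<close>: labels above \<open>x\<close> contribute \<open>1\<close>,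
  and the remaining ones \<open>1 - g y\<close>.
\<close>

lemma integral_branch:
  fixes g :: "real \<Rightarrow> real"
  assumes "continuous_on {0..1} g" "\<And>y. 0 \<le> y \<Longrightarrow> y \<le> 1 \<Longrightarrow> \<phi> y = 1 - g y" "0 \<le> x" "x \<le> 1"
    and meas: "\<phi> \<in> borel_measurable borel"
  shows "(\<integral>y. (if y < x then \<phi> y else 1) \<partial>uniform_measure lborel {0..1}) = 1 - integral {0..x} g"
proof -
  have gx: "continuous_on {0..x} g"
    by (rule continuous_on_subset[OF assms(1)]) (use assms in auto)
  have gi: "set_integrable lborel {0..x} g"
    by (rule borel_integrable_atLeastAtMost') (rule gx)
  have "(\<integral>y. (if y < x then \<phi> y else 1) \<partial>uniform_measure lborel {0..1})
      = (\<integral>y. indicator {0..1} y * (if y < x then \<phi> y else 1) \<partial>lborel)"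
    using meas by (intro integral_uniform_01) simp
  also have "\<dots> = (\<integral>y. indicator {0..1} y - indicator {0..x} y *\<^sub>R g y \<partial>lborel)"
  proof (rule integral_cong_AE)
    have "AE y in lborel. y \<noteq> x" by (rule AE_lborel_singleton)
    then show "AE y in lborel. indicator {0..1} y * (if y < x then \<phi> y else 1)
        = indicator {0..1} y - indicator {0..x} y *\<^sub>R g y"
      by eventually_elim (use assms in \<open>auto split: split_indicator\<close>)
    show "(\<lambda>y. indicator {0..1} y - indicator {0..x} y *\<^sub>R g y) \<in> borel_measurable lborel"
      using gi by (auto simp: set_integrable_def)
  qed (use meas in measurable)
  also have "\<dots> = 1 - integral {0..x} g"
    using gi set_borel_integral_eq_integral(2)[OF gi]
    by (subst Bochner_Integration.integral_diff) (auto simp: set_integrable_def set_lebesgue_integral_def)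
  finally show ?thesis .
qed

text \<open>
  The product over the children in \<open>gen_weight_Suc\<close> has independent factors, since the factor of child
  \<open>i\<close> is a function of the labels on the block of edges starting with \<open>i\<close>. Within a block, the label
  \<open>[i]\<close> is independent of the labels further down, so Fubini's theorem reduces the factor to the
  expected weight of a tree with a deterministic root label.
\<close>

lemma expectation_gen_weight:
  assumes "iid_uniform_edges n M U" "0 \<le> c" "c \<le> 1" "0 \<le> z" "z \<le> 1" "0 \<le> x" "x \<le> 1"
  shows "(\<integral>\<omega>. gen_weight n c z k x (\<lambda>e. U e \<omega>) \<partial>M) = 1 - deficit n c z k x"
  using assms(1,6,7)
proof (induction k arbitrary: x U)
  case 0
  then interpret prob_space M by (simp add: iid_uniform_edges_def)
  show ?case by (simp add: gen_weight_0 prob_space)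
next
  case (Suc k)
  then interpret prob_space M by (simp add: iid_uniform_edges_def)
  have ind: "indep_vars (\<lambda>_. borel) U (tree_edges n)"
    and unif: "\<And>e. e \<in> tree_edges n \<Longrightarrow> distr M borel (U e) = uniform_measure lborel {0..1}"
    using Suc by (auto simp: iid_uniform_edges_def)
  define h where "h = (\<lambda>(y, r). if y < x then gen_weight n c z k y r else 1)"
  have h_meas: "h \<in> borel_measurable (borel \<Otimes>\<^sub>M edge_labels n)"
    unfolding h_def case_prod_beta
    using measurable_gen_weight[of n c z k, unfolded case_prod_beta] by measurable
  have h_bounds: "0 \<le> h p" "h p \<le> 1" for p
    using gen_weight_bounds[OF assms(2-5)] by (auto simp: h_def split: prod.splits)
  define V where "V = (\<lambda>i \<omega>. \<lambda>w\<in>tree_edges n. U (i # w) \<omega>)"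
  define B where "B = (\<lambda>i. insert [i] ((#) i ` tree_edges n))"
  have B: "B i \<subseteq> tree_edges n" if "i < n" for i
    using that by (auto simp: B_def tree_edges_single tree_edges_Cons)

  (* The blocks of edges below distinct children are disjoint. *)
  have branches: "indep_vars (\<lambda>_. borel) (\<lambda>i \<omega>. h (U [i] \<omega>, V i \<omega>)) {..<n}"
  proof -
    have "indep_vars (\<lambda>i. PiM (B i) (\<lambda>_. borel)) (\<lambda>i \<omega>. \<lambda>e\<in>B i. U e \<omega>) {..<n}"
      by (rule indep_vars_restrict[OF ind]) (use B in \<open>auto simp: disjoint_family_on_def B_def\<close>)
    then have "indep_vars (\<lambda>_. borel)
        (\<lambda>i \<omega>. (\<lambda>u. h (u [i], \<lambda>w\<in>tree_edges n. u (i # w))) (\<lambda>e\<in>B i. U e \<omega>)) {..<n}"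
    proof (rule indep_vars_compose2)
      fix i
      show "(\<lambda>u. h (u [i], \<lambda>w\<in>tree_edges n. u (i # w))) \<in> borel_measurable (PiM (B i) (\<lambda>_. borel))"
        by (intro measurable_compose[OF _ h_meas] measurable_Pair measurable_component_singleton
            measurable_subtree_labels) (auto simp: B_def)
    qed
    also have "(\<lambda>i \<omega>. (\<lambda>u. h (u [i], \<lambda>w\<in>tree_edges n. u (i # w))) (\<lambda>e\<in>B i. U e \<omega>))
        = (\<lambda>i \<omega>. h (U [i] \<omega>, V i \<omega>))"
      by (auto simp: B_def V_def fun_eq_iff cong: restrict_cong)
    finally show ?thesis .
  qed

  have branch: "(\<integral>\<omega>. h (U [i] \<omega>, V i \<omega>) \<partial>M) = 1 - integral {0..x} (deficit n c z k)" if i: "i < n" for i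
  proof -
    (* Both members of an indep_var pair have values in one type, so the single label is carried as a
       labelling of the one edge [i]. *)
    define X where "X = (\<lambda>\<omega>. \<lambda>e\<in>{[i]}. U e \<omega>)"
    let ?S = "PiM {[i]} (\<lambda>_. borel :: real measure)"
    have rv: "random_variable borel (U [i])" "random_variable ?S X" "random_variable (edge_labels n) (V i)"
      unfolding V_def X_def using ind i tree_edges_single tree_edges_Cons
      by (auto simp: indep_vars_def intro!: measurable_restrict)
    interpret D1: prob_space "distr M ?S X" by (rule prob_space_distr) fact
    interpret D2: prob_space "distr M (edge_labels n) (V i)" by (rule prob_space_distr) fact
    interpret D: pair_prob_space "distr M ?S X" "distr M (edge_labels n) (V i)" ..
    have "indep_var ?S X (edge_labels n) (V i)"
    proof -
      have "indep_var ?S X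
              (PiM ((#) i ` tree_edges n) (\<lambda>_. borel)) (\<lambda>\<omega>. \<lambda>e\<in>(#) i ` tree_edges n. U e \<omega>)"
        unfolding X_def
        using i by (intro indep_var_restrict[OF ind]) (auto simp: tree_edges_def tree_vertices_def)
      from indep_var_compose[OF this measurable_ident measurable_subtree_labels[of n i]]
      show ?thesis
        by (auto simp: o_def V_def cong: restrict_cong)
    qed
    then have joint: "distr M ?S X \<Otimes>\<^sub>M distr M (edge_labels n) (V i)
        = distr M (?S \<Otimes>\<^sub>M edge_labels n) (\<lambda>\<omega>. (X \<omega>, V i \<omega>))"
      by (simp add: indep_var_distribution_eq)
    define h' where "h' = (\<lambda>p :: (nat list \<Rightarrow> real) \<times> (nat list \<Rightarrow> real). h (fst p [i], snd p))"
    have h'_meas: "h' \<in> borel_measurable (?S \<Otimes>\<^sub>M edge_labels n)"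
      unfolding h'_def
      by (intro measurable_compose[OF _ h_meas] measurable_Pair measurable_snd
          measurable_compose[OF measurable_fst] measurable_component_singleton) simp
    have h'_int: "integrable (distr M ?S X \<Otimes>\<^sub>M distr M (edge_labels n) (V i)) h'"
      using h'_meas h_bounds by (intro D.integrable_const_bound[of _ 1]) (auto simp: joint h'_def)
    define \<phi> where "\<phi> = (\<lambda>y. \<integral>r. gen_weight n c z k y r \<partial>distr M (edge_labels n) (V i))"
    have \<phi>: "\<phi> y = 1 - deficit n c z k y" if "0 \<le> y" "y \<le> 1" for y
    proof -
      have "gen_weight n c z k y \<in> borel_measurable (edge_labels n)"
        using measurable_compose[OF measurable_Pair1' measurable_gen_weight[of n c z k], of y] by simp
      then have "\<phi> y = (\<integral>\<omega>. gen_weight n c z k y (V i \<omega>) \<partial>M)"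
        unfolding \<phi>_def using rv by (intro integral_distr) auto
      also have "\<dots> = (\<integral>\<omega>. gen_weight n c z k y (\<lambda>w. U (i # w) \<omega>) \<partial>M)"
        by (intro Bochner_Integration.integral_cong gen_weight_cong) (auto simp: V_def)
      also have "\<dots> = 1 - deficit n c z k y"
        using that by (intro Suc.IH iid_uniform_edges_subtree Suc.prems i) auto
      finally show ?thesis .
    qed
    have \<phi>_meas: "\<phi> \<in> borel_measurable borel"
    proof -
      have "(\<lambda>(y, r). gen_weight n c z k y r) \<in> borel_measurable (borel \<Otimes>\<^sub>M distr M (edge_labels n) (V i))"
        using measurable_gen_weight[of n c z k] by (simp cong: measurable_cong_sets)
      then show ?thesis
        unfolding \<phi>_def by (rule D2.borel_measurable_lebesgue_integral)
    qed
    have "(\<integral>\<omega>. h (U [i] \<omega>, V i \<omega>) \<partial>M) = (\<integral>\<omega>. h' (X \<omega>, V i \<omega>) \<partial>M)"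
      by (simp add: h'_def X_def)
    also have "\<dots> = (\<integral>p. h' p \<partial>distr M (?S \<Otimes>\<^sub>M edge_labels n) (\<lambda>\<omega>. (X \<omega>, V i \<omega>)))"
      using rv h'_meas by (intro integral_distr[symmetric]) auto
    also have "\<dots> = (\<integral>u. (\<integral>r. h' (u, r) \<partial>distr M (edge_labels n) (V i)) \<partial>distr M ?S X)"
      unfolding joint[symmetric] using D.integral_fst'[OF h'_int] by simp
    also have "\<dots> = (\<integral>u. (if u [i] < x then \<phi> (u [i]) else 1) \<partial>distr M ?S X)"
      by (intro Bochner_Integration.integral_cong) (auto simp: h'_def h_def \<phi>_def D2.prob_space[simplified])
    also have "\<dots> = (\<integral>\<omega>. (if U [i] \<omega> < x then \<phi> (U [i] \<omega>) else 1) \<partial>M)"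
    proof -
      have "(\<lambda>u. if u [i] < x then \<phi> (u [i]) else 1) \<in> borel_measurable ?S"
        using measurable_compose[OF measurable_component_singleton[of "[i]" "{[i]}" "\<lambda>_. borel :: real measure"],
            of "\<lambda>y. if y < x then \<phi> y else 1" borel] \<phi>_meas by simp
      moreover have "X \<omega> [i] = U [i] \<omega>" for \<omega> by (simp add: X_def)
      ultimately show ?thesis by (subst integral_distr[OF rv(2)]) (simp_all cong: if_cong)
    qed
    also have "\<dots> = (\<integral>y. (if y < x then \<phi> y else 1) \<partial>distr M borel (U [i]))"
      using \<phi>_meas by (subst integral_distr[OF rv(1)]) auto
    also have "\<dots> = (\<integral>y. (if y < x then \<phi> y else 1) \<partial>uniform_measure lborel {0..1})"
      unfolding unif[OF tree_edges_single[OF i]] ..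
    also have "\<dots> = 1 - integral {0..x} (deficit n c z k)"
      using Suc \<phi> \<phi>_meas deficit_continuous[OF assms(2-5)] by (intro integral_branch) auto
    finally show ?thesis .
  qed

  have "gen_weight n c z (Suc k) x (\<lambda>e. U e \<omega>) = c * (\<Prod>i<n. h (U [i] \<omega>, V i \<omega>))" for \<omega>
  proof -
    have "gen_weight n c z k y (\<lambda>w. U (i # w) \<omega>) = gen_weight n c z k y (V i \<omega>)" for y i
      by (rule gen_weight_cong) (auto simp: V_def)
    then show ?thesis by (simp add: gen_weight_Suc h_def cong: if_cong)
  qed
  then have "(\<integral>\<omega>. gen_weight n c z (Suc k) x (\<lambda>e. U e \<omega>) \<partial>M) = c * (\<integral>\<omega>. (\<Prod>i<n. h (U [i] \<omega>, V i \<omega>)) \<partial>M)"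
    by simp
  also have "(\<integral>\<omega>. (\<Prod>i<n. h (U [i] \<omega>, V i \<omega>)) \<partial>M) = (\<Prod>i<n. \<integral>\<omega>. h (U [i] \<omega>, V i \<omega>) \<partial>M)"
    using branches h_bounds
    by (intro indep_vars_lebesgue_integral integrable_const_bound[of _ 1]) (auto simp: indep_vars_def)
  also have "\<dots> = (1 - integral {0..x} (deficit n c z k)) ^ n"
    by (simp add: branch)
  finally show ?case by simp
qed

section \<open>Estimates for the size\<close>

text \<open>
  Integrating \<open>j\<close> times produces the powers divided by factorials that appear in both bounds on the
  height and in the truncation error for the size.
\<close>

lemma has_integral_shifted_power:
  fixes n t a x :: real
  assumes "n > 0" "t = n * a" "a \<le> x"
  shows "((\<lambda>y. n * ((n * y - t) ^ j / fact j)) has_integral (n * x - t) ^ Suc j / fact (Suc j)) {a..x}"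
proof -
  have "((\<lambda>y. (n * y - t) ^ Suc j / fact (Suc j)) has_vector_derivative
          n * ((n * y - t) ^ j / fact j)) (at y within {a..x})" for y
    unfolding has_real_derivative_iff_has_vector_derivative[symmetric]
  proof -
    have "((\<lambda>y. n * y - t) has_real_derivative n) (at y within {a..x})"
      by (auto intro!: derivative_eq_intros)
    from DERIV_cdivide[OF DERIV_power[OF this, of "Suc j"], of "fact (Suc j)"]
    show "((\<lambda>y. (n * y - t) ^ Suc j / fact (Suc j)) has_real_derivative
            n * ((n * y - t) ^ j / fact j)) (at y within {a..x})"
      by (simp del: of_nat_Suc power_Suc)
  qed
  from fundamental_theorem_of_calculus[OF assms(3) this]
  show ?thesis using assms by simp
qed

text \<open>
  The function \<open>g x = (1 - s) * exp (n * x)\<close> is a fixed point of the linear upper bound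
  \<open>(1 - s) + n * integral {0..x} g\<close>.
\<close>

lemma size_deficit_le:
  assumes "n \<ge> 1" "0 \<le> s" "s \<le> 1" "0 \<le> x" "x \<le> 1"
  shows "deficit n s s k x \<le> (1 - s) * exp (n * x)"
  using assms(4,5)
proof (induction k arbitrary: x)
  case 0
  have "(1 - s) * 1 \<le> (1 - s) * exp (n * x)"
    using assms 0 by (intro mult_left_mono) auto
  then show ?case by simp
next
  case (Suc k)
  have hi: "((\<lambda>y. n * ((1 - s) * exp (n * y))) has_integral (1 - s) * exp (n * x) - (1 - s) * exp (real n * 0)) {0..x}"
    using Suc by (intro fundamental_theorem_of_calculus)
      (auto intro!: derivative_eq_intros simp: has_real_derivative_iff_has_vector_derivative[symmetric])
  have "deficit n s s (Suc k) x \<le> (1 - s) + n * integral {0..x} (deficit n s s k)"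
    using deficit_Suc_le[of s s x n k] assms Suc by simp
  also have "n * integral {0..x} (deficit n s s k) = integral {0..x} (\<lambda>y. n * deficit n s s k y)"
    by simp
  also have "\<dots> \<le> integral {0..x} (\<lambda>y. n * ((1 - s) * exp (n * y)))"
    using Suc hi assms
    by (intro integral_le integrable_on_mult_right deficit_integrable has_integral_integrable[OF hi])
       (auto intro!: mult_left_mono)
  also have "\<dots> = (1 - s) * exp (n * x) - (1 - s)"
    using integral_unique[OF hi] by simp
  finally show ?case by simp
qed

text \<open>
  On the nonnegative axis \<open>exp (- a)\<close> is decreasing and \<open>1\<close>-Lipschitz.
\<close>

lemma exp_minus_diff_le:
  fixes a b d :: real
  assumes "0 \<le> a" "b - a \<le> d" "0 \<le> d"
  shows "exp (- a) - exp (- b) \<le> d"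
proof -
  have "exp (- a) - exp (- b) = exp (- a) * (1 - exp (a - b))"
    by (simp add: algebra_simps exp_diff exp_minus divide_inverse)
  moreover have "1 - exp (a - b) \<le> d"
    using exp_ge_add_one_self[of "a - b"] assms by linarith
  moreover have "exp (- a) * (1 - exp (a - b)) \<le> exp (- a) * d"
    using calculation by (intro mult_left_mono) auto
  moreover have "exp (- a) * d \<le> 1 * d"
    using assms by (intro mult_right_mono) auto
  ultimately show ?thesis by linarith
qed

text \<open>
  The function \<open>G x = 1 - s / (s + (1 - s) * exp (n * x))\<close> solves the equation
  \<open>G x = 1 - s * exp (- n * integral {0..x} G)\<close> exactly, because
  \<open>ln (s + (1 - s) * exp (n * x))\<close> is the primitive of \<open>n * G\<close>. By the Lipschitz property of the
  exponential, the error of starting the iteration from \<open>1 - s\<close> instead of \<open>G\<close> shrinks like the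
  \<open>k\<close>-fold iterated integral of \<open>1\<close>.
\<close>

lemma size_deficit_ge:
  assumes n: "n \<ge> 1" and s: "0 < s" "s < 1" and "0 \<le> x" "x \<le> 1"
  shows "deficit n s s k x \<ge> 1 - s / (s + (1 - s) * exp (n * x)) - (n * x) ^ k / fact k"
  using assms(4,5)
proof (induction k arbitrary: x)
  case 0
  have "0 < s / (s + (1 - s) * exp (n * x))"
    using s by (intro divide_pos_pos add_pos_pos) auto
  then show ?case using s by simp
next
  case (Suc k)
  let ?g = "deficit n s s k"
  define G :: "real \<Rightarrow> real" where "G = (\<lambda>y. 1 - s / (s + (1 - s) * exp (real n * y)))"
  define D where "D = (n * x) ^ Suc k / fact (Suc k)"
  have pos: "s + (1 - s) * exp (n * y) > 0" for y :: real
    using s by (intro add_pos_pos) auto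
  have hG: "((\<lambda>y. n * G y) has_integral
      ln (s + (1 - s) * exp (n * x)) - ln (s + (1 - s) * exp (real n * 0))) {0..x}"
  proof (intro fundamental_theorem_of_calculus)
    fix y :: real
    show "((\<lambda>y. ln (s + (1 - s) * exp (n * y))) has_vector_derivative n * G y) (at y within {0..x})"
      unfolding has_real_derivative_iff_has_vector_derivative[symmetric] G_def
      using pos[of y] by (auto intro!: derivative_eq_intros simp: field_simps)
  qed (use Suc in auto)
  have hD: "((\<lambda>y. n * ((n * y) ^ k / fact k)) has_integral D) {0..x}"
    using has_integral_shifted_power[of n 0 0 x k] Suc n by (simp add: D_def)
  have ig: "?g integrable_on {0..x}"
    using s Suc by (intro deficit_integrable) auto
  have "ln (s + (1 - s) * exp (n * x)) - D
      = integral {0..x} (\<lambda>y. n * G y - n * ((n * y) ^ k / fact k))"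
    using integral_unique[OF has_integral_diff[OF hG hD]] by simp
  also have "\<dots> \<le> integral {0..x} (\<lambda>y. n * ?g y)"
  proof (intro integral_le integrable_on_mult_right ig
      has_integral_integrable[OF has_integral_diff[OF hG hD]])
    fix y assume "y \<in> {0..x}"
    then have "G y - (n * y) ^ k / fact k \<le> ?g y"
      using Suc by (auto simp: G_def)
    then show "n * G y - n * ((n * y) ^ k / fact k) \<le> n * ?g y"
      unfolding right_diff_distrib[symmetric] by (intro mult_left_mono) auto
  qed
  also have "\<dots> = n * integral {0..x} ?g" by simp
  finally have *: "ln (s + (1 - s) * exp (n * x)) - n * integral {0..x} ?g \<le> D" by simp
  have "exp (- (n * integral {0..x} ?g)) - exp (- ln (s + (1 - s) * exp (n * x))) \<le> D"
    using Suc s n deficit_integral_bounds(1)[of s s x n k]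
    by (intro exp_minus_diff_le *) (auto simp: D_def)
  then have "s * (exp (- (n * integral {0..x} ?g)) - exp (- ln (s + (1 - s) * exp (n * x)))) \<le> 1 * D"
    using s Suc n by (intro order_trans[OF mult_left_mono mult_right_mono]) (auto simp: D_def)
  then have "s * exp (- (n * integral {0..x} ?g)) \<le> s / (s + (1 - s) * exp (n * x)) + D"
    using pos[of x] by (simp add: exp_minus algebra_simps divide_inverse)
  moreover have "1 - s * exp (- (n * integral {0..x} ?g)) \<le> deficit n s s (Suc k) x"
    using s Suc by (intro deficit_Suc_ge) auto
  ultimately show ?case
    unfolding D_def by linarith
qed

section \<open>Estimates for the height\<close>

text \<open>
  The right-hand side is the expected size of level \<open>k\<close>: there are \<open>n ^ k\<close> words, and the labels
  along each of them are decreasing and below \<open>x\<close> with probability \<open>x ^ k / fact k\<close>.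
\<close>

lemma nonempty_level_le:
  assumes "n \<ge> 1" "0 \<le> x" "x \<le> 1"
  shows "deficit n 1 0 k x \<le> (n * x) ^ k / fact k"
  using assms(2,3)
proof (induction k arbitrary: x)
  case (Suc k)
  have hi: "((\<lambda>y. n * ((n * y) ^ k / fact k)) has_integral (n * x) ^ Suc k / fact (Suc k)) {0..x}"
    using has_integral_shifted_power[of n 0 0 x k] Suc assms(1) by simp
  have "deficit n 1 0 (Suc k) x \<le> n * integral {0..x} (deficit n 1 0 k)"
    using deficit_Suc_le[of 1 0 x n k] Suc by simp
  also have "\<dots> = integral {0..x} (\<lambda>y. n * deficit n 1 0 k y)"
    by simp
  also have "\<dots> \<le> integral {0..x} (\<lambda>y. n * ((n * y) ^ k / fact k))"
    using Suc hi assms(1)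
    by (intro integral_le integrable_on_mult_right deficit_integrable has_integral_integrable[OF hi])
       (auto intro!: mult_left_mono simp del: times_divide_eq_right)
  also have "\<dots> = (n * x) ^ Suc k / fact (Suc k)"
    using hi by (rule integral_unique)
  finally show ?case .
qed simp

lemma power_over_fact_le_exp:
  fixes t :: real
  assumes "0 \<le> t"
  shows "t ^ j / fact j \<le> exp t"
proof -
  have "(\<Sum>i\<in>{j}. t ^ i / fact i) \<le> (\<Sum>i. t ^ i / fact i)"
    using assms summable_exp[of t] by (intro sum_le_suminf) (auto simp: divide_inverse mult.commute)
  then show ?thesis
    by (simp add: exp_def divide_inverse mult.commute)
qed

text \<open>
  Within a window of length \<open>L\<close> beyond \<open>\<tau>\<close> the iterated integrals of \<open>q\<close> stay below \<open>q * exp L \<le> \<eta>\<close>.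
  There \<open>1 - exp (- y) \<ge> (1 - \<eta>) * y\<close>, so each nonlinear step loses only a factor \<open>1 - \<eta>\<close> against
  integration.
\<close>

lemma nonempty_level_block:
  fixes \<eta> q L \<tau> :: real
  assumes n: "n \<ge> 1" and \<eta>: "0 < \<eta>" "\<eta> < 1" and q: "0 \<le> q" "q * exp L \<le> \<eta>" and "0 \<le> \<tau>"
    and start: "\<And>x. \<tau> / n \<le> x \<Longrightarrow> x \<le> 1 \<Longrightarrow> q \<le> deficit n 1 0 k x"
    and x: "\<tau> \<le> n * x" "n * x \<le> \<tau> + L" "x \<le> 1"
  shows "(1 - \<eta>) ^ j * q * ((n * x - \<tau>) ^ j / fact j) \<le> deficit n 1 0 (k + j) x"
  using x
proof (induction j arbitrary: x)
  case 0
  then show ?case using start[of x] n by (simp add: field_simps)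
next
  case (Suc j)
  define C where "C = (1 - \<eta>) ^ j * q"
  define a where "a = \<tau> / n"
  define t where "t = n * x - \<tau>"
  define y where "y = C * (t ^ Suc j / fact (Suc j))"
  have t: "0 \<le> t" "t \<le> L" using Suc by (auto simp: t_def)
  have C: "0 \<le> C" "C \<le> q" using \<eta> q by (auto simp: C_def power_le_one mult_left_le_one_le)
  have a: "0 \<le> a" "a \<le> x" "n * a = \<tau>"
    using Suc n \<open>0 \<le> \<tau>\<close> by (auto simp: a_def field_simps)
  have hi: "((\<lambda>y. n * ((n * y - \<tau>) ^ j / fact j)) has_integral t ^ Suc j / fact (Suc j)) {a..x}"
    using has_integral_shifted_power[of n \<tau> a x j] a n by (simp add: t_def)
  note hi' = has_integral_mult_right[OF hi, of C, folded y_def]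
  have "y = integral {a..x} (\<lambda>y. C * (n * ((n * y - \<tau>) ^ j / fact j)))"
    using integral_unique[OF hi'] by simp
  also have "\<dots> \<le> integral {a..x} (\<lambda>y. n * deficit n 1 0 (k + j) y)"
  proof (intro integral_le has_integral_integrable[OF hi'] integrable_on_mult_right deficit_integrable)
    fix y assume "y \<in> {a..x}"
    then have y: "a \<le> y" "y \<le> x" by auto
    have "n * a \<le> n * y" "n * y \<le> n * x" using y by (auto intro!: mult_left_mono)
    then have "C * ((n * y - \<tau>) ^ j / fact j) \<le> deficit n 1 0 (k + j) y"
      unfolding C_def using Suc y a by (intro Suc.IH) auto
    from mult_left_mono[OF this, of n]
    show "C * (n * ((n * y - \<tau>) ^ j / fact j)) \<le> n * deficit n 1 0 (k + j) y"
      by (simp add: mult_ac)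
  qed (use a Suc in auto)
  also have "\<dots> = n * integral {a..x} (deficit n 1 0 (k + j))" by simp
  also have "\<dots> \<le> n * integral {0..x} (deficit n 1 0 (k + j))"
    using a Suc by (intro mult_left_mono integral_subset_le deficit_integrable)
      (auto intro: deficit_nonneg)
  finally have le: "y \<le> n * integral {0..x} (deficit n 1 0 (k + j))" .
  have y0: "0 \<le> y" using C t by (auto simp: y_def)
  have "y \<le> q * exp L"
    unfolding y_def using C t q power_over_fact_le_exp[of t "Suc j"]
    by (intro mult_mono order_trans[OF power_over_fact_le_exp]) auto
  then have y\<eta>: "y \<le> \<eta>" using q by simp
  have "(1 - \<eta>) * y \<le> 1 - exp (- y)"
  proof -
    have "exp (- y) \<le> 1 / (1 + y)"
      using exp_ge_add_one_self[of y] y0 by (simp add: exp_minus field_simps)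
    moreover have "(1 - \<eta>) * y * (1 + y) \<le> y"
    proof -
      have "(1 - \<eta>) * (1 + y) = 1 - \<eta> + y - \<eta> * y" by (simp add: algebra_simps)
      also have "\<dots> \<le> 1" using y\<eta> mult_nonneg_nonneg[of \<eta> y] y0 \<eta> by linarith
      finally show ?thesis using mult_right_mono[of "(1 - \<eta>) * (1 + y)" 1 y] y0 by (simp add: mult_ac)
    qed
    then have "(1 - \<eta>) * y \<le> y / (1 + y)"
      using y0 by (simp add: pos_le_divide_eq)
    moreover have "y / (1 + y) = 1 - 1 / (1 + y)"
      using y0 by (simp add: field_simps)
    ultimately show ?thesis by linarith
  qed
  also have "\<dots> \<le> 1 - exp (- (n * integral {0..x} (deficit n 1 0 (k + j))))"
    using le by simp
  also have "\<dots> \<le> deficit n 1 0 (Suc (k + j)) x"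
    using deficit_Suc_ge[of 1 0 x n "k + j"] a Suc by simp
  finally show ?case
    by (simp add: y_def C_def t_def mult_ac)
qed

text \<open>
  After one block of \<open>m\<close> generations the bound \<open>q\<close> is recovered at distance \<open>L\<close>, by the choice of \<open>m\<close>
  and \<open>L\<close>, and it extends to the right by monotonicity in \<open>x\<close>. The constant \<open>q\<close> depends neither on
  \<open>n\<close> nor on the number \<open>i\<close> of blocks.
\<close>

lemma nonempty_level_travels:
  fixes \<eta> q L :: real
  assumes n: "n \<ge> 1" and \<eta>: "0 < \<eta>" "\<eta> < 1" and q: "0 \<le> q" "q * exp L \<le> \<eta>" and L: "0 \<le> L"
    and m: "fact m \<le> ((1 - \<eta>) * L) ^ m"
    and "i * L \<le> n * x" "x \<le> 1"
  shows "q \<le> deficit n 1 0 (i * m) x"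
  using assms(8,9)
proof (induction i arbitrary: x)
  case 0
  have "q * 1 \<le> q * exp L" using q L by (intro mult_left_mono) auto
  then show ?case using q \<eta> by simp
next
  case (Suc i)
  define w where "w = (Suc i * L) / n"
  have w: "0 \<le> w" "w \<le> x" "n * w = i * L + L"
    using Suc n L by (auto simp: w_def field_simps)
  have "q * 1 \<le> q * (((1 - \<eta>) * L) ^ m / fact m)"
    using m q by (intro mult_left_mono) auto
  also have "\<dots> = (1 - \<eta>) ^ m * q * ((n * w - i * L) ^ m / fact m)"
    using w by (simp add: power_mult_distrib mult_ac)
  also have "\<dots> \<le> deficit n 1 0 (i * m + m) w"
    using w L Suc.prems
    by (intro nonempty_level_block[OF n \<eta> q] Suc.IH) (use n in \<open>auto simp: field_simps\<close>)
  also have "\<dots> \<le> deficit n 1 0 (i * m + m) x"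
    using w Suc by (intro deficit_mono) auto
  finally show ?case by (simp add: add.commute)
qed

text \<open>
  About \<open>n * \<delta>\<close> children of the root have a label in the window \<open>{p - \<delta>..p}\<close>, and each of them starts
  an independent attempt that succeeds with probability at least \<open>q\<close>.
\<close>

lemma nonempty_level_boost:
  fixes q \<delta> p :: real
  assumes "0 \<le> q" "0 \<le> \<delta>" "\<delta> \<le> p" "p \<le> 1"
    and q: "\<And>x. p - \<delta> \<le> x \<Longrightarrow> x \<le> 1 \<Longrightarrow> q \<le> deficit n 1 0 k x"
  shows "1 - exp (- (n * (\<delta> * q))) \<le> deficit n 1 0 (Suc k) p"
proof -
  have "\<delta> * q = integral {p - \<delta>..p} (\<lambda>_. q)" using assms by simp
  also have "\<dots> \<le> integral {p - \<delta>..p} (deficit n 1 0 k)"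
    using assms by (intro integral_le deficit_integrable) auto
  also have "\<dots> \<le> integral {0..p} (deficit n 1 0 k)"
    using assms by (intro integral_subset_le deficit_integrable) (auto intro: deficit_nonneg)
  finally have "n * (\<delta> * q) \<le> n * integral {0..p} (deficit n 1 0 k)"
    by (intro mult_left_mono) auto
  then have "1 - exp (- (n * (\<delta> * q))) \<le> 1 - exp (- (n * integral {0..p} (deficit n 1 0 k)))"
    by simp
  also have "\<dots> \<le> deficit n 1 0 (Suc k) p"
    using deficit_Suc_ge[of 1 0 p n k] assms by simp
  finally show ?thesis .
qed

text \<open>
  Stirling's formula up to a factor of order \<open>sqrt m\<close>. The induction step amounts to
  \<open>exp 1 \<le> (1 + 1 / m) ^ (m + 1)\<close>.
\<close>

lemma fact_le_exp_power:
  "m \<ge> 1 \<Longrightarrow> fact m \<le> exp 1 * m * (real m / exp 1) ^ m"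
proof (induction m rule: nat_induct_at_least)
  case (Suc m)
  have "exp 1 \<le> (1 + 1 / m) ^ Suc m"
  proof -
    have "ln (real m / real (Suc m)) \<le> real m / real (Suc m) - 1"
      using Suc by (intro ln_le_minus_one) auto
    then have "1 \<le> Suc m * ln (1 + 1 / m)"
      using Suc by (simp add: ln_div field_simps)
    then have "exp 1 \<le> exp (Suc m * ln (1 + 1 / m))" by simp
    also have "\<dots> = (1 + 1 / m) ^ Suc m"
      using Suc by (simp add: exp_of_nat_mult add_pos_nonneg del: of_nat_Suc power_Suc)
    finally show ?thesis .
  qed
  then have "exp 1 * real m ^ Suc m \<le> (1 + 1 / m) ^ Suc m * real m ^ Suc m"
    by (intro mult_right_mono) auto
  also have "\<dots> = real (Suc m) ^ Suc m"
  proof -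
    have "(1 + 1 / m) * m = Suc m" using Suc by (simp add: field_simps)
    then show ?thesis by (simp only: power_mult_distrib[symmetric])
  qed
  finally have *: "exp 1 * real m ^ Suc m \<le> real (Suc m) ^ Suc m" .
  have "fact (Suc m) = Suc m * (fact m :: real)" by simp
  also have "\<dots> \<le> Suc m * (exp 1 * m * (real m / exp 1) ^ m)"
    using Suc by (intro mult_left_mono) auto
  also have "\<dots> = Suc m * (exp 1 * real m ^ Suc m) / exp 1 ^ m"
    by (simp add: power_divide)
  also have "\<dots> \<le> Suc m * (real (Suc m) ^ Suc m) / exp 1 ^ m"
    using * by (intro divide_right_mono mult_left_mono) auto
  also have "\<dots> = exp 1 * Suc m * (real (Suc m) / exp 1) ^ Suc m"
    by (simp add: power_divide)
  finally show ?case .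
qed simp

text \<open>
  With \<open>L = m / \<kappa>\<close>, Stirling's formula shows \<open>L ^ m / fact m\<close> to be of order
  \<open>(exp 1 / \<kappa>) ^ m\<close> up to a polynomial factor. Half of this exponential growth, measured by
  \<open>\<rho> = sqrt (exp 1 / \<kappa>)\<close>, pays for the loss \<open>(1 - \<eta>) ^ m\<close>, and the other half beats the polynomial.
\<close>

lemma supercritical_block_exists:
  fixes \<kappa> :: real
  assumes \<kappa>: "0 < \<kappa>" "\<kappa> < exp 1"
  obtains m :: nat and \<eta> where "m \<ge> 1" "0 < \<eta>" "\<eta> < 1" "fact m \<le> ((1 - \<eta>) * (m / \<kappa>)) ^ m"
proof -
  define \<rho> where "\<rho> = sqrt (exp 1 / \<kappa>)"
  have \<rho>: "\<rho> > 1" using \<kappa> by (simp add: \<rho>_def)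
  have "((\<lambda>m. real m / \<rho> ^ m) \<longlongrightarrow> 0) sequentially"
    using \<rho> by real_asymp
  then have "\<forall>\<^sub>F m in sequentially. real m / \<rho> ^ m < 1 / exp 1"
    by (rule order_tendstoD) simp
  with eventually_ge_at_top[of 1] have "\<forall>\<^sub>F m in sequentially. m \<ge> 1 \<and> real m / \<rho> ^ m < 1 / exp 1"
    by (rule eventually_conj)
  then obtain m where m: "m \<ge> 1" "real m / \<rho> ^ m < 1 / exp 1"
    using eventually_happens'[OF sequentially_bot] by blast
  have "fact m \<le> exp 1 * m * (real m / exp 1) ^ m"
    using m by (intro fact_le_exp_power) auto
  also have "\<dots> \<le> \<rho> ^ m * (real m / exp 1) ^ m"
    using m \<rho> by (intro mult_right_mono) (auto simp: field_simps)
  also have "\<dots> = (1 / \<rho> * (m / \<kappa>)) ^ m"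
  proof -
    have "\<rho> * \<rho> = exp 1 / \<kappa>" using \<kappa> by (simp add: \<rho>_def)
    then have "\<rho> * (m / exp 1) = 1 / \<rho> * (m / \<kappa>)"
      using \<rho> \<kappa> by (simp add: field_simps)
    then show ?thesis by (simp only: power_mult_distrib[symmetric])
  qed
  finally show ?thesis
    using m \<rho> by (intro that[of m "1 - 1 / \<rho>"]) auto
qed

text \<open>
  Since \<open>k ^ k / fact k \<le> exp k\<close>, the expression is at most \<open>(exp 1 / \<kappa>) ^ k\<close>.
\<close>

lemma expected_level_size_tendsto_0:
  fixes p \<kappa> :: real
  assumes p: "0 < p" "p \<le> 1" and \<kappa>: "exp 1 < \<kappa>"
  shows "(\<lambda>n. (n * p) ^ nat \<lceil>\<kappa> * (n * p)\<rceil> / fact (nat \<lceil>\<kappa> * (n * p)\<rceil>)) \<longlonglongrightarrow> 0"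
proof -
  define k where "k = (\<lambda>n::nat. nat \<lceil>\<kappa> * (n * p)\<rceil>)"
  have k0: "0 < \<kappa>" using \<kappa> exp_gt_zero[of "1::real"] by linarith
  have k: "k n \<ge> \<kappa> * (n * p)" for n unfolding k_def by linarith
  have upper: "(n * p) ^ k n / fact (k n) \<le> (exp 1 / \<kappa>) ^ k n" for n
  proof -
    have np: "n * p \<le> k n / \<kappa>" using k[of n] k0 by (simp add: field_simps)
    have "(n * p) ^ k n / fact (k n) \<le> (k n / \<kappa>) ^ k n / fact (k n)"
      using np p by (intro divide_right_mono power_mono) auto
    also have "\<dots> = (1 / \<kappa>) ^ k n * (real (k n) ^ k n / fact (k n))"
      by (simp add: power_divide)
    also have "\<dots> \<le> (1 / \<kappa>) ^ k n * exp (k n)"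
      using k0 by (intro mult_left_mono power_over_fact_le_exp) auto
    also have "exp (k n) = exp (1::real) ^ k n"
      by (metis exp_of_nat_mult mult.right_neutral)
    finally show "(n * p) ^ k n / fact (k n) \<le> (exp 1 / \<kappa>) ^ k n"
      by (simp add: power_divide)
  qed
  have "filterlim (\<lambda>n::nat. \<kappa> * (n * p)) at_top sequentially"
    using k0 p by real_asymp
  then have "filterlim k at_top sequentially"
    unfolding filterlim_sequentially_iff_filterlim_real
    by (rule filterlim_at_top_mono) (auto simp: k)
  then have "(\<lambda>n. (exp 1 / \<kappa>) ^ k n) \<longlonglongrightarrow> 0"
    using \<kappa> k0 by (intro filterlim_compose[OF LIMSEQ_power_zero]) auto
  then have "(\<lambda>n. (n * p) ^ k n / fact (k n)) \<longlonglongrightarrow> 0"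
    by (rule tendsto_sandwich[rotated 3, where f = "\<lambda>_. 0"])
       (use p in \<open>auto intro!: always_eventually upper\<close>)
  then show ?thesis unfolding k_def .
qed

text \<open>
  Blocks with a speed \<open>\<kappa>1\<close> strictly between \<open>\<kappa>\<close> and \<open>exp 1\<close> reach far enough even after a
  proportion \<open>\<delta>\<close> of the available labels has been set aside for the boost at the root.
\<close>

lemma nonempty_level_tendsto_1:
  fixes p \<kappa> :: real
  assumes p: "0 < p" "p \<le> 1" and \<kappa>: "\<kappa> < exp 1"
  obtains k :: "nat \<Rightarrow> nat" where
    "\<forall>\<^sub>F n in sequentially. \<kappa> * (n * p) \<le> k n" "(\<lambda>n. deficit n 1 0 (k n) p) \<longlonglongrightarrow> 1"
proof -
  (* The maximum with 1 only keeps the speed positive when the given bound is not. *)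
  define \<kappa>1 where "\<kappa>1 = (max \<kappa> 1 + exp 1) / 2"
  have \<kappa>1: "\<kappa> < \<kappa>1" "0 < \<kappa>1" "\<kappa>1 < exp 1"
    using \<kappa> exp_ge_add_one_self[of "1::real"] unfolding \<kappa>1_def
    by (auto simp: max_def split: if_splits)
  obtain m :: nat and \<eta> where m: "m \<ge> 1" and \<eta>: "0 < \<eta>" "\<eta> < 1"
    and fm: "fact m \<le> ((1 - \<eta>) * (m / \<kappa>1)) ^ m"
    using supercritical_block_exists[OF \<kappa>1(2,3)] by blast
  define L where "L = m / \<kappa>1"
  have L: "L > 0" using m \<kappa>1 by (simp add: L_def)
  define q where "q = \<eta> * exp (- L)"
  have q: "0 < q" "q * exp L \<le> \<eta>" using \<eta> by (auto simp: q_def exp_minus)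
  (* Chosen so that (1 - \<delta>) * \<kappa>1 is the midpoint of \<kappa>1 and the positive part of \<kappa>. *)
  define \<delta> where "\<delta> = (1 - max \<kappa> 0 / \<kappa>1) / 2"
  have \<delta>: "0 < \<delta>" "\<delta> < 1" using \<kappa>1 by (auto simp: \<delta>_def field_simps)
  have slope: "\<kappa> < (1 - \<delta>) * \<kappa>1"
    using \<kappa>1 by (auto simp: \<delta>_def field_simps max_def)
  define i where "i = (\<lambda>n::nat. nat \<lfloor>(1 - \<delta>) * (n * p) / L\<rfloor>)"
  show thesis
  proof (rule that[of "\<lambda>n. Suc (i n * m)"])
    have "\<forall>\<^sub>F n::nat in sequentially. \<kappa> * (n * p) \<le> (1 - \<delta>) * \<kappa>1 * (n * p) - m"
    proof -
      have "filterlim (\<lambda>n::nat. ((1 - \<delta>) * \<kappa>1 - \<kappa>) * p * n) at_top sequentially"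
        using slope p by real_asymp
      then have "\<forall>\<^sub>F n::nat in sequentially. real m \<le> ((1 - \<delta>) * \<kappa>1 - \<kappa>) * p * n"
        by (simp add: filterlim_at_top)
      then show ?thesis by eventually_elim (simp add: algebra_simps)
    qed
    then show "\<forall>\<^sub>F n in sequentially. \<kappa> * (n * p) \<le> Suc (i n * m)"
    proof eventually_elim
      case (elim n)
      have "(1 - \<delta>) * (n * p) / L - 1 \<le> i n" unfolding i_def by linarith
      then have "((1 - \<delta>) * (n * p) / L - 1) * m \<le> real (i n) * m" by (intro mult_right_mono) auto
      moreover have "((1 - \<delta>) * (n * p) / L - 1) * m = (1 - \<delta>) * \<kappa>1 * (n * p) - m"
        using m \<kappa>1 by (simp add: L_def field_simps)
      ultimately show ?case using elim by simp
    qed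
    show "(\<lambda>n. deficit n 1 0 (Suc (i n * m)) p) \<longlonglongrightarrow> 1"
    proof (rule tendsto_sandwich[where h = "\<lambda>_. 1"])
      show "\<forall>\<^sub>F n in sequentially. 1 - exp (- (n * (\<delta> * p * q))) \<le> deficit n 1 0 (Suc (i n * m)) p"
        using eventually_ge_at_top[of 1]
      proof eventually_elim
        case (elim n)
        have "i n \<le> (1 - \<delta>) * (n * p) / L"
          unfolding i_def using \<delta> p L by (intro of_nat_floor) auto
        then have iL: "i n * L \<le> n * (p - \<delta> * p)" using L by (simp add: field_simps)
        show ?case
        proof (rule nonempty_level_boost)
          fix x assume x: "p - \<delta> * p \<le> x" "x \<le> 1"
          have "n * (p - \<delta> * p) \<le> n * x" using x by (intro mult_left_mono) auto
          with iL have "i n * L \<le> n * x" by (rule order_trans)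
          then show "q \<le> deficit n 1 0 (i n * m) x"
            using \<eta> q L fm[folded L_def] x elim
            by (intro nonempty_level_travels[where L=L and \<eta>=\<eta>]) auto
        qed (use \<delta> p q in \<open>auto simp: mult_left_le_one_le\<close>)
      qed
      have "(\<lambda>n::nat. 1 - exp (- (n * C))) \<longlonglongrightarrow> 1" if "C > 0" for C :: real
        using that by real_asymp
      then show "(\<lambda>n::nat. 1 - exp (- (n * (\<delta> * p * q)))) \<longlonglongrightarrow> 1"
        using \<delta> p q by simp
    qed (use p in \<open>auto intro!: always_eventually deficit_le_1 simp del: deficit.simps\<close>)
  qed
qed

section \<open>Tail probabilities\<close>

lemma random_variable_gen_weight:
  assumes "iid_uniform_edges n M U"
  shows "(\<lambda>\<omega>. gen_weight n c z k x (\<lambda>e. U e \<omega>)) \<in> borel_measurable M"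
proof -
  interpret prob_space M using assms by (simp add: iid_uniform_edges_def)
  have "(\<lambda>\<omega>. (x, \<lambda>e\<in>tree_edges n. U e \<omega>)) \<in> M \<rightarrow>\<^sub>M borel \<Otimes>\<^sub>M edge_labels n"
    using assms by (intro measurable_Pair measurable_restrict) (auto simp: iid_uniform_edges_def indep_vars_def)
  from measurable_compose[OF this measurable_gen_weight[of n c z k]]
  show ?thesis
    by (auto cong: gen_weight_cong)
qed

lemma prob_level_nonempty:
  assumes iid: "iid_uniform_edges n M U" and x: "0 \<le> x" "x \<le> 1"
  shows "{\<omega> \<in> space M. tree_level k (temporal_tree n x (\<lambda>e. U e \<omega>)) \<noteq> {}} \<in> sets M" (is "?A \<in> _")
    and "measure M {\<omega> \<in> space M. tree_level k (temporal_tree n x (\<lambda>e. U e \<omega>)) \<noteq> {}} = deficit n 1 0 k x"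
proof -
  interpret prob_space M using assms by (simp add: iid_uniform_edges_def)
  let ?w = "\<lambda>\<omega>. gen_weight n 1 0 k x (\<lambda>e. U e \<omega>)"
  have w: "1 - ?w \<omega> = indicator ?A \<omega>" if "\<omega> \<in> space M" for \<omega>
    using that finite_tree_level[of k n x "\<lambda>e. U e \<omega>"] by (auto simp: gen_weight_def split: split_indicator)
  have "?A = {\<omega> \<in> space M. ?w \<omega> = 0}"
    using finite_tree_level[of k n x] by (auto simp: gen_weight_def card_gt_0_iff)
  then show A: "?A \<in> sets M"
    using random_variable_gen_weight[OF iid, of 1 0 k x] by simp
  have "measure M ?A = (\<integral>\<omega>. 1 - ?w \<omega> \<partial>M)"
    using A w by (subst Bochner_Integration.integral_cong[OF refl w]) auto
  also have "\<dots> = 1 - (\<integral>\<omega>. ?w \<omega> \<partial>M)"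
    using random_variable_gen_weight[OF iid, of 1 0 k x] gen_weight_bounds[of 1 0 n k x]
    by (subst Bochner_Integration.integral_diff) (auto intro!: integrable_const_bound[of _ 1] simp: prob_space)
  also have "\<dots> = deficit n 1 0 k x"
    using x by (subst expectation_gen_weight[OF iid]) auto
  finally show "measure M ?A = deficit n 1 0 k x" .
qed

lemma gen_weight_diagonal:
  "gen_weight n s s k x u = s ^ card (tree_below (Suc k) (temporal_tree n x u))"
proof -
  let ?T = "temporal_tree n x u"
  have "tree_below (Suc k) ?T = tree_below k ?T \<union> tree_level k ?T"
    by (auto simp: tree_below_def tree_level_def)
  moreover have "card (tree_below k ?T \<union> tree_level k ?T) = card (tree_below k ?T) + card (tree_level k ?T)"
    by (intro card_Un_disjoint finite_tree_below finite_tree_level) (auto simp: tree_below_def tree_level_def)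
  ultimately show ?thesis
    by (simp add: gen_weight_def power_add)
qed

text \<open>
  Markov's inequality for \<open>1 - W\<close> and for \<open>W\<close>, where \<open>W = exp (- N / A)\<close> is the generating weight with
  \<open>s = exp (- 1 / A)\<close>; the events are \<open>W < exp (- 1)\<close> and \<open>W > exp (- 1)\<close>.
\<close>

lemma size_tails:
  fixes A :: real and k :: nat
  assumes iid: "iid_uniform_edges n M U" and n: "n \<ge> 1" and x: "0 \<le> x" "x \<le> 1" and A: "A > 0"
  defines "N \<equiv> \<lambda>\<omega>. real (card (tree_below (Suc k) (temporal_tree n x (\<lambda>e. U e \<omega>))))"
  shows "{\<omega> \<in> space M. A < N \<omega>} \<in> sets M" and "{\<omega> \<in> space M. N \<omega> < A} \<in> sets M"
    and "measure M {\<omega> \<in> space M. A < N \<omega>} \<le> exp (n * x) / A / (1 - exp (- 1))"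
    and "measure M {\<omega> \<in> space M. N \<omega> < A} \<le> exp 1 * (A * exp (- (n * x)) + (n * x) ^ k / fact k)"
proof -
  interpret prob_space M using assms by (simp add: iid_uniform_edges_def)
  define s where "s = exp (- (1 / A))"
  have s: "0 < s" "s < 1" using A by (auto simp: s_def)
  define W where "W = (\<lambda>\<omega>. gen_weight n s s k x (\<lambda>e. U e \<omega>))"
  have W_eq: "W \<omega> = exp (- (N \<omega> / A))" for \<omega>
    by (simp add: W_def gen_weight_diagonal s_def N_def exp_of_nat_mult[symmetric])
  have W_meas[measurable]: "W \<in> borel_measurable M"
    unfolding W_def by (rule random_variable_gen_weight[OF iid])
  have W: "0 \<le> W \<omega>" "W \<omega> \<le> 1" for \<omega>
    using gen_weight_bounds[of s s] s by (auto simp: W_def)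
  have int: "integrable M W"
    using W by (intro integrable_const_bound[of _ 1]) auto
  have EW: "expectation W = 1 - deficit n s s k x"
    unfolding W_def using s x by (intro expectation_gen_weight[OF iid]) auto
  have iff: "A < N \<omega> \<longleftrightarrow> W \<omega> < exp (- 1)" "N \<omega> < A \<longleftrightarrow> exp (- 1) < W \<omega>" for \<omega>
    using A by (auto simp: W_eq)
  show "{\<omega> \<in> space M. A < N \<omega>} \<in> sets M" "{\<omega> \<in> space M. N \<omega> < A} \<in> sets M"
    unfolding iff by measurable
  have e1: "exp (- 1) < (1::real)" by simp
  have "prob {\<omega> \<in> space M. A < N \<omega>} \<le> prob {\<omega> \<in> space M. 1 - W \<omega> \<ge> 1 - exp (- 1)}"
    unfolding iff by (intro finite_measure_mono) auto
  also have "\<dots> \<le> expectation (\<lambda>\<omega>. 1 - W \<omega>) / (1 - exp (- 1))"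
    using e1 W int by (intro integral_Markov_inequality_measure[where A = "{}"]) auto
  also have "expectation (\<lambda>\<omega>. 1 - W \<omega>) = deficit n s s k x"
    using int by (subst Bochner_Integration.integral_diff) (auto simp: EW prob_space)
  also have "\<dots> \<le> (1 - s) * exp (n * x)"
    using n s x by (intro size_deficit_le) auto
  also have "\<dots> \<le> (1 / A) * exp (n * x)"
    using exp_ge_add_one_self[of "- (1 / A)"] unfolding s_def by (intro mult_right_mono) auto
  finally show "prob {\<omega> \<in> space M. A < N \<omega>} \<le> exp (n * x) / A / (1 - exp (- 1))"
    using e1 by (simp add: divide_right_mono)
  have "prob {\<omega> \<in> space M. N \<omega> < A} \<le> prob {\<omega> \<in> space M. W \<omega> \<ge> exp (- 1)}"
    unfolding iff by (intro finite_measure_mono) auto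
  also have "\<dots> \<le> expectation W / exp (- 1)"
    using W int by (intro integral_Markov_inequality_measure[where A = "{}"]) auto
  also have "\<dots> = exp 1 * (1 - deficit n s s k x)"
    by (simp add: EW exp_minus field_simps)
  also have "\<dots> \<le> exp 1 * (A * exp (- (n * x)) + (n * x) ^ k / fact k)"
  proof (intro mult_left_mono)
    have "s / (s + (1 - s) * exp (n * x)) \<le> s / ((1 - s) * exp (n * x))"
      using s by (intro divide_left_mono mult_pos_pos add_pos_pos) auto
    also have "\<dots> = s / (1 - s) * exp (- (n * x))"
      by (simp add: exp_minus divide_inverse)
    also have "\<dots> \<le> A * exp (- (n * x))"
    proof (intro mult_right_mono)
      have "s * (1 + 1 / A) \<le> s * exp (1 / A)"
        using s exp_ge_add_one_self[of "1 / A"] by (intro mult_left_mono) auto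
      also have "\<dots> = 1" by (simp add: s_def exp_minus)
      finally have "s \<le> A * (1 - s)" using A by (simp add: field_simps)
      then show "s / (1 - s) \<le> A" using s by (simp add: pos_divide_le_eq)
    qed simp
    finally show "1 - deficit n s s k x \<le> A * exp (- (n * x)) + (n * x) ^ k / fact k"
      using size_deficit_ge[OF n s x, of k] by linarith
  qed simp
  finally show "prob {\<omega> \<in> space M. N \<omega> < A} \<le> exp 1 * (A * exp (- (n * x)) + (n * x) ^ k / fact k)" .
qed

section \<open>Functionals of the tree\<close>

text \<open>
  A finite tree is one of countably many, and each of them is cut out by countably many label
  comparisons; on the remaining event the functional takes its default value \<open>c\<close>.
\<close>

lemma measurable_tree_functional:
  fixes f :: "nat list set \<Rightarrow> real"
  assumes iid: "iid_uniform_edges n M U"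
    and inf: "\<And>S. S \<subseteq> lists {..<n} \<Longrightarrow> infinite S \<Longrightarrow> f S = c"
  shows "(\<lambda>\<omega>. f (temporal_tree n x (\<lambda>e. U e \<omega>))) \<in> borel_measurable M"
proof -
  let ?T = "\<lambda>\<omega>. temporal_tree n x (\<lambda>e. U e \<omega>)"
  interpret prob_space M using iid by (simp add: iid_uniform_edges_def)
  have U: "U e \<in> borel_measurable M" if "e \<in> tree_edges n" for e
    using iid that by (auto simp: iid_uniform_edges_def indep_vars_def)
  have vertex: "{\<omega> \<in> space M. v \<in> ?T \<omega>} \<in> sets M" for v
  proof (cases "v \<in> tree_vertices n")
    case True
    have [measurable]: "(\<lambda>\<omega>. vertex_label x (\<lambda>e. U e \<omega>) (take k v)) \<in> borel_measurable M" for k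
    proof (cases "take k v = []")
      case False
      then have "take k v \<in> tree_edges n"
        using True by (auto simp: tree_edges_def tree_vertices_def dest: in_set_takeD)
      then show ?thesis using False U by (simp add: vertex_label_def)
    qed (simp add: vertex_label_def)
    have "{\<omega> \<in> space M. v \<in> ?T \<omega>} = {\<omega> \<in> space M. \<forall>i\<in>{0..length v}. \<forall>j\<in>{0..length v}. i < j \<longrightarrow>
        vertex_label x (\<lambda>e. U e \<omega>) (take j v) < vertex_label x (\<lambda>e. U e \<omega>) (take i v)}"
      using True by (auto simp: temporal_tree_def monotone_on_def)
    also have "\<dots> \<in> sets M" by measurable
    finally show ?thesis .
  qed (auto simp: temporal_tree_def)
  have eq: "{\<omega> \<in> space M. ?T \<omega> = S} \<in> sets M" for S
  proof -
    have "{\<omega> \<in> space M. ?T \<omega> = S} = {\<omega> \<in> space M. \<forall>v. v \<in> ?T \<omega> \<longleftrightarrow> v \<in> S}" by auto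
    also have "\<dots> \<in> sets M"
      using vertex by (intro sets.sets_Collect_countable_All sets.sets_Collect) auto
    finally show ?thesis .
  qed
  show ?thesis
  proof (rule measurableI)
    fix B :: "real set" assume "B \<in> sets borel"
    define F where "F = (\<lambda>B. \<Union>S\<in>{S. finite S \<and> f S \<in> B}. {\<omega> \<in> space M. ?T \<omega> = S})"
    have F: "F B \<in> sets M" for B
      unfolding F_def using eq
      by (intro sets.countable_UN'' countable_subset[OF _ countable_Collect_finite]) auto
    have "(\<lambda>\<omega>. f (?T \<omega>)) -` B \<inter> space M = F B \<union> (if c \<in> B then space M - F UNIV else {})"
      using inf[OF temporal_tree_subset[of n x]] by (auto simp: F_def split: if_splits)
    then show "(\<lambda>\<omega>. f (?T \<omega>)) -` B \<inter> space M \<in> sets M" using F by auto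
  qed simp
qed

lemma take_in_temporal_tree:
  assumes "v \<in> temporal_tree n x u"
  shows "take k v \<in> temporal_tree n x u"
proof -
  have "take k v \<in> lists {..<n}"
    using assms by (auto simp: temporal_tree_def tree_vertices_def dest: in_set_takeD)
  moreover have "strict_antimono_on {0..length v} (\<lambda>j. vertex_label x u (take j v))"
    using assms by (simp add: temporal_tree_def)
  then have "strict_antimono_on {0..length (take k v)} (\<lambda>j. vertex_label x u (take j (take k v)))"
    by (auto simp: monotone_on_def min_def)
  ultimately show ?thesis by (simp add: temporal_tree_def tree_vertices_def)
qed

text \<open>
  By closure under prefixes, an empty level leaves all deeper levels empty as well.
\<close>

lemma empty_level_tree:
  assumes "tree_level k (temporal_tree n x u) = {}"
  shows "tree_below k (temporal_tree n x u) = temporal_tree n x u"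
    and "finite (temporal_tree n x u)" and "tree_height (temporal_tree n x u) < k"
proof -
  let ?T = "temporal_tree n x u"
  have "length v < k" if "v \<in> ?T" for v
    using assms take_in_temporal_tree[OF that, of k] by (force simp: tree_level_def)
  then show eq: "tree_below k ?T = ?T" by (auto simp: tree_below_def)
  then show fin: "finite ?T" using finite_tree_below[of k n x u] by simp
  show "tree_height ?T < k"
    unfolding tree_height_def using fin eq Nil_in_temporal_tree[of n x u]
    by (subst Max_less_iff) (auto simp: tree_below_def)
qed

lemma tree_height_ge:
  assumes "tree_level k T \<noteq> {}" "finite T"
  shows "k \<le> tree_height T"
  using assms unfolding tree_height_def tree_level_def by (auto intro!: Max_ge)

text \<open>
  Over a finite alphabet, infinitely many words have unbounded lengths, and \<open>Max\<close> of an infinite set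
  is the fixed value \<open>the None\<close>.
\<close>

lemma tree_height_infinite:
  assumes "S \<subseteq> lists {..<n::nat}" "infinite S"
  shows "tree_height S = the None"
proof -
  have "infinite (length ` S)"
  proof
    assume "finite (length ` S)"
    then obtain b where "\<And>v. v \<in> S \<Longrightarrow> length v < b"
      unfolding finite_nat_set_iff_bounded by auto
    then have "S \<subseteq> {v \<in> lists {..<n}. length v < b}" using assms by blast
    then show False using assms finite_words finite_subset by blast
  qed
  then show ?thesis by (simp add: tree_height_def Max.infinite)
qed

section \<open>Convergence in probability\<close>

lemma tends_in_probI:
  assumes "\<And>n. n \<ge> 1 \<Longrightarrow> X n \<in> borel_measurable (M n)"
    and "\<And>\<epsilon>. \<epsilon> > 0 \<Longrightarrow> \<exists>b. b \<longlonglongrightarrow> 0 \<and>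
      (\<forall>\<^sub>F n in sequentially. measure (M n) {\<omega> \<in> space (M n). \<bar>X n \<omega> - c\<bar> > \<epsilon>} \<le> b n)"
  shows "tends_in_prob M X c"
  unfolding tends_in_prob_def
proof (intro conjI allI impI)
  show "\<forall>\<^sub>F n in sequentially. X n \<in> borel_measurable (M n)"
    using eventually_ge_at_top[of 1] by eventually_elim (rule assms)
  fix \<epsilon> :: real assume "\<epsilon> > 0"
  then obtain b where b: "b \<longlonglongrightarrow> 0"
    "\<forall>\<^sub>F n in sequentially. measure (M n) {\<omega> \<in> space (M n). \<bar>X n \<omega> - c\<bar> > \<epsilon>} \<le> b n"
    using assms(2) by blast
  show "(\<lambda>n. measure (M n) {\<omega> \<in> space (M n). \<bar>X n \<omega> - c\<bar> > \<epsilon>}) \<longlonglongrightarrow> 0"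
    by (rule tendsto_sandwich[OF _ b(2) tendsto_const b(1)]) simp
qed

lemma tends_in_prob_divide:
  assumes X: "tends_in_prob M X a" and Y: "tends_in_prob M Y b" and "b \<noteq> 0"
    and M: "\<And>n. n \<ge> 1 \<Longrightarrow> prob_space (M n)"
    and Z: "\<And>n \<omega>. n \<ge> 1 \<Longrightarrow> Z n \<omega> = X n \<omega> / Y n \<omega>"
    and Z_meas: "\<And>n. n \<ge> 1 \<Longrightarrow> Z n \<in> borel_measurable (M n)"
  shows "tends_in_prob M Z (a / b)"
proof (rule tends_in_probI[OF Z_meas])
  fix \<epsilon> :: real assume \<epsilon>: "\<epsilon> > 0"
  have "isCont (\<lambda>q. fst q / snd q) (a, b)"
    using \<open>b \<noteq> 0\<close> by (intro continuous_intros) auto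
  then obtain \<delta> where \<delta>: "\<delta> > 0" "\<And>q. dist q (a, b) < \<delta> \<Longrightarrow> dist (fst q / snd q) (a / b) < \<epsilon>"
    using \<epsilon> unfolding continuous_at_eps_delta by force
  have close: "\<bar>x / y - a / b\<bar> \<le> \<epsilon>" if "\<bar>x - a\<bar> \<le> \<delta> / 3" "\<bar>y - b\<bar> \<le> \<delta> / 3" for x y
  proof -
    have "dist (x, y) (a, b) \<le> \<bar>x - a\<bar> + \<bar>y - b\<bar>"
      using sqrt_sum_squares_le_sum_abs[of "x - a" "y - b"] by (simp add: dist_Pair_Pair dist_real_def)
    also have "\<dots> < \<delta>" using that \<delta>(1) by linarith
    finally show ?thesis using \<delta>(2)[of "(x, y)"] by (simp add: dist_real_def)
  qed
  have "\<delta> / 3 > 0" using \<delta>(1) by simp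
  define PX where "PX = (\<lambda>n. {\<omega> \<in> space (M n). \<bar>X n \<omega> - a\<bar> > \<delta> / 3})"
  define PY where "PY = (\<lambda>n. {\<omega> \<in> space (M n). \<bar>Y n \<omega> - b\<bar> > \<delta> / 3})"
  have lim: "(\<lambda>n. measure (M n) (PX n)) \<longlonglongrightarrow> 0" "(\<lambda>n. measure (M n) (PY n)) \<longlonglongrightarrow> 0"
    and XY: "\<forall>\<^sub>F n in sequentially. X n \<in> borel_measurable (M n)"
      "\<forall>\<^sub>F n in sequentially. Y n \<in> borel_measurable (M n)"
    using X Y \<open>\<delta> / 3 > 0\<close> unfolding tends_in_prob_def PX_def PY_def by blast+
  have "\<forall>\<^sub>F n in sequentially. measure (M n) {\<omega> \<in> space (M n). \<bar>Z n \<omega> - a / b\<bar> > \<epsilon>}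
      \<le> measure (M n) (PX n) + measure (M n) (PY n)"
    using XY eventually_ge_at_top[of 1]
  proof eventually_elim
    case (elim n)
    interpret prob_space "M n" using elim by (intro M)
    note [measurable] = elim(1,2)
    have [measurable]: "PX n \<in> sets (M n)" "PY n \<in> sets (M n)" by (simp_all add: PX_def PY_def)
    have "{\<omega> \<in> space (M n). \<bar>Z n \<omega> - a / b\<bar> > \<epsilon>} \<subseteq> PX n \<union> PY n"
    proof (rule subsetI, rule ccontr)
      fix \<omega> assume *: "\<omega> \<in> {\<omega> \<in> space (M n). \<bar>Z n \<omega> - a / b\<bar> > \<epsilon>}" "\<omega> \<notin> PX n \<union> PY n"
      then have "\<bar>X n \<omega> / Y n \<omega> - a / b\<bar> \<le> \<epsilon>" by (intro close) (auto simp: PX_def PY_def)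
      with * show False using Z elim by simp
    qed
    then have "prob {\<omega> \<in> space (M n). \<bar>Z n \<omega> - a / b\<bar> > \<epsilon>} \<le> prob (PX n \<union> PY n)"
      by (intro finite_measure_mono) auto
    also have "\<dots> \<le> prob (PX n) + prob (PY n)" by (intro measure_Un_le) auto
    finally show ?case .
  qed
  moreover have "(\<lambda>n. measure (M n) (PX n) + measure (M n) (PY n)) \<longlonglongrightarrow> 0"
    using tendsto_add[OF lim] by simp
  ultimately show "\<exists>b'. b' \<longlonglongrightarrow> 0 \<and> (\<forall>\<^sub>F n in sequentially.
      measure (M n) {\<omega> \<in> space (M n). \<bar>Z n \<omega> - a / b\<bar> > \<epsilon>} \<le> b' n)" by blast
qed auto

text \<open>
  The height exceeds \<open>(exp 1 + \<epsilon>) * n * p\<close> only if the corresponding level is inhabited, and if the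
  tree is finite it falls below \<open>(exp 1 - \<epsilon>) * n * p\<close> only if the corresponding level is empty. That
  the tree is finite comes from the empty level that yields the upper bound.
\<close>

lemma tends_in_prob_height:
  fixes p :: real
  assumes p: "0 < p" "p \<le> 1" and iid: "\<And>n. n \<ge> 1 \<Longrightarrow> iid_uniform_edges n (M n) (U n)"
  shows "tends_in_prob M (\<lambda>n \<omega>. tree_height (temporal_tree n p (\<lambda>e. U n e \<omega>)) / (n * p)) (exp 1)"
proof (rule tends_in_probI)
  let ?T = "\<lambda>n \<omega>. temporal_tree n p (\<lambda>e. U n e \<omega>)"
  fix n :: nat assume n: "n \<ge> 1"
  show "(\<lambda>\<omega>. tree_height (?T n \<omega>) / (n * p)) \<in> borel_measurable (M n)"
    by (rule measurable_tree_functional[OF iid[OF n], where f = "\<lambda>S. tree_height S / (n * p)"])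
       (simp add: tree_height_infinite)
next
  let ?T = "\<lambda>n \<omega>. temporal_tree n p (\<lambda>e. U n e \<omega>)"
  fix \<epsilon> :: real assume \<epsilon>: "\<epsilon> > 0"
  define k where "k = (\<lambda>n::nat. nat \<lceil>(exp 1 + \<epsilon>) * (n * p)\<rceil>)"
  have k_lim: "(\<lambda>n. (n * p) ^ k n / fact (k n)) \<longlonglongrightarrow> 0"
    using expected_level_size_tendsto_0[OF p, of "exp 1 + \<epsilon>"] \<epsilon> by (simp add: k_def)
  obtain j :: "nat \<Rightarrow> nat" where j: "\<forall>\<^sub>F n in sequentially. (exp 1 - \<epsilon>) * (n * p) \<le> j n"
    and j_lim: "(\<lambda>n. deficit n 1 0 (j n) p) \<longlonglongrightarrow> 1"
    using nonempty_level_tendsto_1[OF p, of "exp 1 - \<epsilon>"] \<epsilon> by auto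
  have "\<forall>\<^sub>F n in sequentially. measure (M n) {\<omega> \<in> space (M n).
      \<bar>tree_height (?T n \<omega>) / (n * p) - exp 1\<bar> > \<epsilon>}
      \<le> (n * p) ^ k n / fact (k n) + (1 - deficit n 1 0 (j n) p)"
    using j eventually_ge_at_top[of 1]
  proof eventually_elim
    case (elim n)
    have np: "n * p > 0" using elim p by simp
    note iid = iid[OF elim(2)]
    interpret prob_space "M n" using iid by (simp add: iid_uniform_edges_def)
    define High where "High = {\<omega> \<in> space (M n). tree_level (k n) (?T n \<omega>) \<noteq> {}}"
    define Low where "Low = {\<omega> \<in> space (M n). tree_level (j n) (?T n \<omega>) \<noteq> {}}"
    have [measurable]: "High \<in> sets (M n)" "Low \<in> sets (M n)"
      using prob_level_nonempty(1)[OF iid] p by (auto simp: High_def Low_def)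
    have pr: "prob High = deficit n 1 0 (k n) p" "prob Low = deficit n 1 0 (j n) p"
      using prob_level_nonempty(2)[OF iid] p by (auto simp: High_def Low_def)
    have "{\<omega> \<in> space (M n). \<bar>tree_height (?T n \<omega>) / (n * p) - exp 1\<bar> > \<epsilon>} \<subseteq> High \<union> (space (M n) - Low)"
    proof (rule subsetI, rule ccontr)
      fix \<omega> assume *: "\<omega> \<in> {\<omega> \<in> space (M n). \<bar>tree_height (?T n \<omega>) / (n * p) - exp 1\<bar> > \<epsilon>}"
        "\<omega> \<notin> High \<union> (space (M n) - Low)"
      then have "tree_level (k n) (?T n \<omega>) = {}" and low: "tree_level (j n) (?T n \<omega>) \<noteq> {}"
        by (auto simp: High_def Low_def)
      from empty_level_tree(2,3)[OF this(1)]
      have fin: "finite (?T n \<omega>)" and "tree_height (?T n \<omega>) < k n" .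
      then have "tree_height (?T n \<omega>) \<le> (exp 1 + \<epsilon>) * (n * p)"
        unfolding k_def by linarith
      moreover have "(exp 1 - \<epsilon>) * (n * p) \<le> tree_height (?T n \<omega>)"
        using tree_height_ge[OF low fin] elim(1) by linarith
      ultimately have "tree_height (?T n \<omega>) / (n * p) \<le> exp 1 + \<epsilon>" "exp 1 - \<epsilon> \<le> tree_height (?T n \<omega>) / (n * p)"
        unfolding pos_divide_le_eq[OF np] pos_le_divide_eq[OF np] by auto
      then have "\<bar>tree_height (?T n \<omega>) / (n * p) - exp 1\<bar> \<le> \<epsilon>" by linarith
      with * show False by simp
    qed
    then have "prob {\<omega> \<in> space (M n). \<bar>tree_height (?T n \<omega>) / (n * p) - exp 1\<bar> > \<epsilon>}
        \<le> prob (High \<union> (space (M n) - Low))"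
      by (intro finite_measure_mono) auto
    also have "\<dots> \<le> prob High + prob (space (M n) - Low)" by (intro measure_Un_le) auto
    also have "\<dots> \<le> (n * p) ^ k n / fact (k n) + (1 - deficit n 1 0 (j n) p)"
      using nonempty_level_le[of n p "k n"] elim p by (subst prob_compl) (auto simp: pr)
    finally show ?case .
  qed
  moreover have "(\<lambda>n. (n * p) ^ k n / fact (k n) + (1 - deficit n 1 0 (j n) p)) \<longlonglongrightarrow> 0"
    using tendsto_add[OF k_lim tendsto_diff[OF tendsto_const[of 1] j_lim]] by simp
  ultimately show "\<exists>b. b \<longlonglongrightarrow> 0 \<and> (\<forall>\<^sub>F n in sequentially. measure (M n)
      {\<omega> \<in> space (M n). \<bar>tree_height (?T n \<omega>) / (n * p) - exp 1\<bar> > \<epsilon>} \<le> b n)" by blast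
qed

text \<open>
  Truncation is harmless: outside the event that level \<open>k\<close> is inhabited, the truncated tree is the
  whole tree. Any \<open>k\<close> above \<open>exp 1 * n * p\<close> makes both this event and the truncation error in
  \<open>size_tails\<close> negligible; the slope \<open>exp 1 + 1\<close> is one such choice.
\<close>

lemma tends_in_prob_ln_size:
  fixes p :: real
  assumes p: "0 < p" "p \<le> 1" and iid: "\<And>n. n \<ge> 1 \<Longrightarrow> iid_uniform_edges n (M n) (U n)"
  shows "tends_in_prob M (\<lambda>n \<omega>. ln (card (temporal_tree n p (\<lambda>e. U n e \<omega>))) / (n * p)) 1"
proof (rule tends_in_probI)
  let ?T = "\<lambda>n \<omega>. temporal_tree n p (\<lambda>e. U n e \<omega>)"
  fix n :: nat assume n: "n \<ge> 1"
  show "(\<lambda>\<omega>. ln (card (?T n \<omega>)) / (n * p)) \<in> borel_measurable (M n)"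
    by (rule measurable_tree_functional[OF iid[OF n], where f = "\<lambda>S. ln (card S) / (n * p)" and c = 0]) simp
next
  let ?T = "\<lambda>n \<omega>. temporal_tree n p (\<lambda>e. U n e \<omega>)"
  fix \<epsilon> :: real assume \<epsilon>: "\<epsilon> > 0"
  define k where "k = (\<lambda>n::nat. nat \<lceil>(exp 1 + 1) * (n * p)\<rceil>)"
  define r where "r = (\<lambda>n. (n * p) ^ k n / fact (k n))"
  have r_lim: "r \<longlonglongrightarrow> 0"
    using expected_level_size_tendsto_0[OF p, of "exp 1 + 1"] by (simp add: k_def r_def)
  define t where "t = (\<lambda>n::nat. exp (- (\<epsilon> * (n * p))))"
  have t_lim: "t \<longlonglongrightarrow> 0"
    unfolding t_def using \<epsilon> p by real_asymp
  have "\<forall>\<^sub>F n in sequentially. measure (M n) {\<omega> \<in> space (M n). \<bar>ln (card (?T n \<omega>)) / (n * p) - 1\<bar> > \<epsilon>}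
      \<le> r n + (t n / (1 - exp (- 1)) + exp 1 * (t n + r n))"
    using eventually_ge_at_top[of 1]
  proof eventually_elim
    case (elim n)
    have np: "n * p > 0" using elim p by simp
    note iid = iid[OF elim]
    interpret prob_space "M n" using iid by (simp add: iid_uniform_edges_def)
    define N where "N = (\<lambda>\<omega>. real (card (tree_below (Suc (k n)) (?T n \<omega>))))"
    define High where "High = {\<omega> \<in> space (M n). tree_level (k n) (?T n \<omega>) \<noteq> {}}"
    define Large where "Large = {\<omega> \<in> space (M n). exp ((1 + \<epsilon>) * (n * p)) < N \<omega>}"
    define Small where "Small = {\<omega> \<in> space (M n). N \<omega> < exp ((1 - \<epsilon>) * (n * p))}"
    have [measurable]: "High \<in> sets (M n)" "Large \<in> sets (M n)" "Small \<in> sets (M n)"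
      using prob_level_nonempty(1)[OF iid] size_tails(1,2)[OF iid] elim p
      by (auto simp: High_def Large_def Small_def N_def)
    have "prob High \<le> r n"
      using prob_level_nonempty(2)[OF iid, of p "k n"] nonempty_level_le[of n p "k n"] elim p
      by (auto simp: High_def r_def)
    moreover have "prob Large \<le> t n / (1 - exp (- 1))"
    proof -
      have "exp (n * p) / exp ((1 + \<epsilon>) * (n * p)) = t n"
        unfolding t_def exp_diff[symmetric] by (simp add: algebra_simps)
      then show ?thesis
        using size_tails(3)[OF iid elim, of p "exp ((1 + \<epsilon>) * (n * p))" "k n"] p
        by (simp add: Large_def N_def)
    qed
    moreover have "prob Small \<le> exp 1 * (t n + r n)"
    proof -
      have "exp ((1 - \<epsilon>) * (n * p)) * exp (- (n * p)) = t n"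
        unfolding t_def exp_add[symmetric] by (simp add: algebra_simps)
      then show ?thesis
        using size_tails(4)[OF iid elim, of p "exp ((1 - \<epsilon>) * (n * p))" "k n"] p
        by (simp add: Small_def N_def r_def)
    qed
    moreover have "{\<omega> \<in> space (M n). \<bar>ln (card (?T n \<omega>)) / (n * p) - 1\<bar> > \<epsilon>} \<subseteq> High \<union> (Large \<union> Small)"
    proof (rule subsetI, rule ccontr)
      fix \<omega> assume *: "\<omega> \<in> {\<omega> \<in> space (M n). \<bar>ln (card (?T n \<omega>)) / (n * p) - 1\<bar> > \<epsilon>}"
        "\<omega> \<notin> High \<union> (Large \<union> Small)"
      then have "tree_level (k n) (?T n \<omega>) = {}" by (auto simp: High_def)
      note empty = empty_level_tree[OF this]
      have "length v < k n" if "v \<in> ?T n \<omega>" for v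
      proof -
        have "v \<in> tree_below (k n) (?T n \<omega>)" using that empty(1) by simp
        then show ?thesis by (simp add: tree_below_def)
      qed
      then have "tree_below (Suc (k n)) (?T n \<omega>) = ?T n \<omega>"
        by (auto simp: tree_below_def less_Suc_eq)
      then have N: "exp ((1 - \<epsilon>) * (n * p)) \<le> card (?T n \<omega>)" "card (?T n \<omega>) \<le> exp ((1 + \<epsilon>) * (n * p))"
        using * by (auto simp: Large_def Small_def N_def)
      have pos: "real (card (?T n \<omega>)) > 0"
        using N(1) exp_gt_zero[of "(1 - \<epsilon>) * (n * p)"] by linarith
      have "(1 - \<epsilon>) * (n * p) \<le> ln (card (?T n \<omega>))" "ln (card (?T n \<omega>)) \<le> (1 + \<epsilon>) * (n * p)"
        using N pos ln_le_cancel_iff[OF pos exp_gt_zero, of "(1 + \<epsilon>) * (n * p)"]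
        by (simp_all add: ln_ge_iff)
      then have "ln (card (?T n \<omega>)) / (n * p) \<le> 1 + \<epsilon>" "1 - \<epsilon> \<le> ln (card (?T n \<omega>)) / (n * p)"
        unfolding pos_divide_le_eq[OF np] pos_le_divide_eq[OF np] by auto
      then have "\<bar>ln (card (?T n \<omega>)) / (n * p) - 1\<bar> \<le> \<epsilon>" by linarith
      with * show False by simp
    qed
    then have "prob {\<omega> \<in> space (M n). \<bar>ln (card (?T n \<omega>)) / (n * p) - 1\<bar> > \<epsilon>} \<le> prob (High \<union> (Large \<union> Small))"
      by (intro finite_measure_mono) auto
    moreover have "prob (High \<union> (Large \<union> Small)) \<le> prob High + prob (Large \<union> Small)"
      "prob (Large \<union> Small) \<le> prob Large + prob Small"
      by (intro measure_Un_le; simp)+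
    ultimately show ?case by linarith
  qed
  moreover have "(\<lambda>n. r n + (t n / (1 - exp (- 1)) + exp 1 * (t n + r n))) \<longlonglongrightarrow> 0"
    by (auto intro!: tendsto_eq_intros r_lim t_lim)
  ultimately show "\<exists>b. b \<longlonglongrightarrow> 0 \<and> (\<forall>\<^sub>F n in sequentially. measure (M n)
      {\<omega> \<in> space (M n). \<bar>ln (card (?T n \<omega>)) / (n * p) - 1\<bar> > \<epsilon>} \<le> b n)" by blast
qed

theorem theorem2p2:
  fixes p :: real
    and M :: "nat \<Rightarrow> 'a measure"
    and U :: "nat \<Rightarrow> nat list \<Rightarrow> 'a \<Rightarrow> real"
  assumes "0 < p" and "p \<le> 1"
    and "\<And>n. n \<ge> 1 \<Longrightarrow> iid_uniform_edges n (M n) (U n)"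
  shows "let T = (\<lambda>n \<omega>. temporal_tree n p (\<lambda>e. U n e \<omega>));
             H = (\<lambda>n \<omega>. tree_height (T n \<omega>))
         in tends_in_prob M (\<lambda>n \<omega>. real (H n \<omega>) / (real n * p)) (exp 1) \<and>
            tends_in_prob M (\<lambda>n \<omega>. real (H n \<omega>) / ln (real (card (T n \<omega>)))) (exp 1)"
proof -
  let ?T = "\<lambda>n \<omega>. temporal_tree n p (\<lambda>e. U n e \<omega>)"
  note height = tends_in_prob_height[where M = M and U = U, OF assms]
  note size = tends_in_prob_ln_size[where M = M and U = U, OF assms]
  have "tends_in_prob M (\<lambda>n \<omega>. tree_height (?T n \<omega>) / ln (card (?T n \<omega>))) (exp 1 / 1)"
  proof (rule tends_in_prob_divide[OF height size one_neq_zero])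
    fix n :: nat assume n: "n \<ge> 1"
    show "prob_space (M n)" using assms(3)[OF n] by (simp add: iid_uniform_edges_def)
    show "(\<lambda>\<omega>. tree_height (?T n \<omega>) / ln (card (?T n \<omega>))) \<in> borel_measurable (M n)"
      by (rule measurable_tree_functional[OF assms(3)[OF n], where f = "\<lambda>S. tree_height S / ln (card S)" and c = 0]) simp
    show "tree_height (?T n \<omega>) / ln (card (?T n \<omega>)) =
        tree_height (?T n \<omega>) / (n * p) / (ln (card (?T n \<omega>)) / (n * p))" for \<omega>
      using n assms(1) by simp
  qed
  with height show ?thesis by (simp add: Let_def)
qed

end
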